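(* Let $\varrho$ be a state of an $N$-qubit system and $\sigma$ a state of an $N'$-qubit system, with $\sigma$ not maximally mixed. Then the optimal asymptotic rate of conversion of $\varrho$ into $\sigma$ under noisy operations is $$R(\varrho\to\sigma)=\frac{N-S(\varrho)}{N'-S(\sigma)}.$$
   Context: Logarithms are base $2$ and $S(\varrho)=-\mathrm{Tr}\,\varrho\log\varrho$ is the von Neumann entropy. A state of an $N$-qubit system is a positive semidefinite operator of trace $1$ on $(\mathbb{C}^2)^{\otimes N}$. The maximally mixed state on $\mathbb{C}^K$ is $\tau_K=\mathbb{1}/K$. Noisy operations (NO) are the maps on states obtained as finite compositions of the following: (1) unitary transformations; (2) adding an ancilla in a maximally mixed state, $\varrho\mapsto\varrho\otimes\tau_K$, for an arbitrary finite dimension $K$; (3) discarding a subsystem, i.e. taking the partial trace over a tensor factor of the Hilbert space (for any identification of the Hilbert space with a tensor product $\mathbb{C}^a\otimes\mathbb{C}^b$). Optimal rate: for states $\varrho,\sigma$ on finite-dimensional spaces, $R(\varrho\to\sigma)$ is the supremum of $\lim_{n\to\infty} m_n/n$ over all sequences of nonnegative integers $(m_n)$ for which this limit exists and for which there are noisy operations $\Lambda_n$, with output on the space of $\sigma^{\otimes m_n}$, such that $\|\Lambda_n(\varrho^{\otimes n})-\sigma^{\otimes m_n}\|\to0$ as $n\to\infty$ (trace norm). *)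

theory Defs
  imports
    Complex_Main
    "HOL-Library.Extended_Real"
    "Jordan_Normal_Form.Schur_Decomposition"
begin

text \<open>Operators on the space of dimension \<open>d\<close> are complex \<open>d \<times> d\<close> matrices.\<close>

definition unitary_mat :: "nat \<Rightarrow> complex mat \<Rightarrow> bool" where
  "unitary_mat d U \<longleftrightarrow> U \<in> carrier_mat d d \<and> mat_adjoint U * U = 1\<^sub>m d"

definition mat_trace :: "complex mat \<Rightarrow> complex" where
  "mat_trace A = (\<Sum>i<dim_row A. A $$ (i, i))"

text \<open>In the order on \<^typ>\<open>complex\<close>, \<open>0 \<le> z\<close> says that \<open>z\<close> is real and nonnegative, so that
  matrices satisfying the following are in particular Hermitian.\<close>

definition psd_mat :: "nat \<Rightarrow> complex mat \<Rightarrow> bool" where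
  "psd_mat d A \<longleftrightarrow> A \<in> carrier_mat d d \<and> (\<forall>v \<in> carrier_vec d. 0 \<le> (A *\<^sub>v v) \<bullet>c v)"

definition state :: "nat \<Rightarrow> complex mat \<Rightarrow> bool" where
  "state d \<rho> \<longleftrightarrow> psd_mat d \<rho> \<and> mat_trace \<rho> = 1"

definition max_mixed :: "nat \<Rightarrow> complex mat" where
  "max_mixed K = (1 / of_nat K) \<cdot>\<^sub>m 1\<^sub>m K"

subsection \<open>Functional calculus, entropy and trace norm\<close>

text \<open>\<open>is_mat_fun f A B\<close>: \<open>B\<close> is \<open>f(A)\<close>, computed from some unitary diagonalization of \<open>A\<close>
  with real eigenvalues.\<close>

definition is_mat_fun :: "(real \<Rightarrow> real) \<Rightarrow> complex mat \<Rightarrow> complex mat \<Rightarrow> bool" where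
  "is_mat_fun f A B \<longleftrightarrow> (\<exists>U (e :: nat \<Rightarrow> real).
     unitary_mat (dim_row A) U \<and>
     A = U * mat_diag (dim_row A) (\<lambda>i. of_real (e i)) * mat_adjoint U \<and>
     B = U * mat_diag (dim_row A) (\<lambda>i. of_real (f (e i))) * mat_adjoint U)"

definition mat_fun :: "(real \<Rightarrow> real) \<Rightarrow> complex mat \<Rightarrow> complex mat" where
  "mat_fun f A = (THE B. is_mat_fun f A B)"

text \<open>The result does not depend on the diagonalization, so the description is proper.\<close>

lemma mat_adjoint_carrier [simp]:
  "(A :: complex mat) \<in> carrier_mat n m \<Longrightarrow> mat_adjoint A \<in> carrier_mat m n"
  by (auto simp: mat_adjoint_def mat_of_rows_def)

lemma unitary_mat_right:
  assumes "unitary_mat d U"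
  shows "U * mat_adjoint U = 1\<^sub>m d"
  using assms mat_mult_left_right_inverse[of "mat_adjoint U" d U]
  by (simp add: unitary_mat_def)

lemma is_mat_fun_unique:
  assumes "is_mat_fun f A B" and "is_mat_fun f A C"
  shows "B = C"
proof -
  define n where "n = dim_row A"
  obtain U and d :: "nat \<Rightarrow> real" where U: "unitary_mat n U"
    and AU: "A = U * mat_diag n (\<lambda>i. of_real (d i)) * mat_adjoint U"
    and BU: "B = U * mat_diag n (\<lambda>i. of_real (f (d i))) * mat_adjoint U"
    using assms(1) unfolding is_mat_fun_def n_def by blast
  obtain V and e :: "nat \<Rightarrow> real" where V: "unitary_mat n V"
    and AV: "A = V * mat_diag n (\<lambda>i. of_real (e i)) * mat_adjoint V"
    and CV: "C = V * mat_diag n (\<lambda>i. of_real (f (e i))) * mat_adjoint V"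
    using assms(2) unfolding is_mat_fun_def n_def by blast
  define U' V' where "U' = mat_adjoint U" and "V' = mat_adjoint V"
  define W where "W = V' * U"
  let ?D = "mat_diag n (\<lambda>i. of_real (d i)) :: complex mat"
  let ?E = "mat_diag n (\<lambda>i. of_real (e i)) :: complex mat"
  let ?fD = "mat_diag n (\<lambda>i. of_real (f (d i))) :: complex mat"
  let ?fE = "mat_diag n (\<lambda>i. of_real (f (e i))) :: complex mat"
  have [simp]: "U \<in> carrier_mat n n" "V \<in> carrier_mat n n"
    using U V by (auto simp: unitary_mat_def)
  then have [simp]: "U' \<in> carrier_mat n n" "V' \<in> carrier_mat n n"
    by (simp_all add: U'_def V'_def)
  have W [simp]: "W \<in> carrier_mat n n"
    unfolding W_def by (rule mult_carrier_mat[of _ n n]) auto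
  have UU: "U' * U = 1\<^sub>m n" "U * U' = 1\<^sub>m n" and VV: "V' * V = 1\<^sub>m n" "V * V' = 1\<^sub>m n"
    using U V unitary_mat_right unfolding U'_def V'_def by (auto simp: unitary_mat_def)
  note assoc = assoc_mult_mat[of _ n n _ n _ n]
  note one = left_mult_one_mat[of _ n n] right_mult_one_mat[of _ n n]
  have c: "X * Y \<in> carrier_mat n n"
    if "X \<in> carrier_mat n n" "Y \<in> carrier_mat n n" for X Y :: "complex mat"
    using that by (rule mult_carrier_mat)
  have "W * ?D = V' * (U * ?D * U') * U"
    unfolding W_def by (simp add: assoc c UU one)
  also have "\<dots> = V' * (V * ?E * V') * U"
    using AU AV by (simp add: U'_def V'_def)
  also have "\<dots> = (V' * V) * ?E * (V' * U)"
    by (simp add: assoc c)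
  also have "\<dots> = ?E * W"
    unfolding W_def VV by (simp add: assoc c one)
  finally have WD: "W * ?D = ?E * W" .
  have "W $$ (i, j) * of_real (f (d j)) = of_real (f (e i)) * W $$ (i, j)"
    if "i < n" "j < n" for i j
  proof -
    have "(W * ?D) $$ (i, j) = (?E * W) $$ (i, j)" using WD by simp
    then have "W $$ (i, j) * of_real (d j) = of_real (e i) * W $$ (i, j)"
      using that by (simp add: mat_diag_mult_left[OF W] mat_diag_mult_right[OF W])
    then show ?thesis by (cases "W $$ (i, j) = 0") auto
  qed
  then have WfD: "W * ?fD = ?fE * W"
    by (intro eq_matI) (auto simp: mat_diag_mult_left[OF W] mat_diag_mult_right[OF W])
  have "B = (V * V') * (U * ?fD * U')"
    unfolding BU U'_def[symmetric] VV by (simp add: c one)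
  also have "\<dots> = V * (W * ?fD) * U'"
    unfolding W_def by (simp add: assoc c)
  also have "\<dots> = V * ?fE * V' * (U * U')"
    unfolding WfD unfolding W_def by (simp add: assoc c)
  also have "\<dots> = C"
    unfolding CV UU V'_def[symmetric] by (simp add: c one)
  finally show ?thesis .
qed

lemma mat_fun_eq: "is_mat_fun f A B \<Longrightarrow> mat_fun f A = B"
  unfolding mat_fun_def using is_mat_fun_unique by (blast intro: the_equality)

text \<open>As \<^prop>\<open>log 2 0 = (0 :: real)\<close>, zero eigenvalues contribute \<open>0 log 0 = 0\<close>.\<close>

definition entropy :: "complex mat \<Rightarrow> real" where
  "entropy \<rho> = - Re (mat_trace (\<rho> * mat_fun (log 2) \<rho>))"

definition trace_norm :: "complex mat \<Rightarrow> real" where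
  "trace_norm A = Re (mat_trace (mat_fun sqrt (mat_adjoint A * A)))"

subsection \<open>Tensor products and partial trace\<close>

text \<open>The basis vector \<open>e\<^sub>i \<otimes> e\<^sub>k\<close> of the tensor product of spaces of dimensions \<open>a\<close> and \<open>b\<close> has
  index \<open>i * b + k\<close>.\<close>

definition tensor_mat :: "complex mat \<Rightarrow> complex mat \<Rightarrow> complex mat" where
  "tensor_mat A B = mat (dim_row A * dim_row B) (dim_col A * dim_col B)
     (\<lambda>(i, j). A $$ (i div dim_row B, j div dim_col B) * B $$ (i mod dim_row B, j mod dim_col B))"

fun tensor_pow :: "complex mat \<Rightarrow> nat \<Rightarrow> complex mat" where
  "tensor_pow A 0 = 1\<^sub>m 1"
| "tensor_pow A (Suc n) = tensor_mat A (tensor_pow A n)"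

definition partial_trace :: "nat \<Rightarrow> nat \<Rightarrow> complex mat \<Rightarrow> complex mat" where
  "partial_trace a b A = mat a a (\<lambda>(i, j). \<Sum>k<b. A $$ (i * b + k, j * b + k))"

subsection \<open>Noisy operations and the optimal rate\<close>

text \<open>In \<open>discard\<close>, the unitary \<open>W\<close> is the identification of the space of dimension \<open>a * b\<close> with
  a tensor product; since \<open>W\<close> may contain a swap, discarding the second factor is no loss of
  generality.\<close>

inductive noisy_step :: "nat \<Rightarrow> nat \<Rightarrow> (complex mat \<Rightarrow> complex mat) \<Rightarrow> bool" where
  unitary: "unitary_mat d U \<Longrightarrow> noisy_step d d (\<lambda>\<rho>. U * \<rho> * mat_adjoint U)"
| ancilla: "K > 0 \<Longrightarrow> noisy_step d (d * K) (\<lambda>\<rho>. tensor_mat \<rho> (max_mixed K))"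
| discard: "unitary_mat (a * b) W \<Longrightarrow>
    noisy_step (a * b) a (\<lambda>\<rho>. partial_trace a b (W * \<rho> * mat_adjoint W))"

inductive noisy_op :: "nat \<Rightarrow> nat \<Rightarrow> (complex mat \<Rightarrow> complex mat) \<Rightarrow> bool" where
  step: "noisy_step d d' \<Lambda> \<Longrightarrow> noisy_op d d' \<Lambda>"
| comp: "noisy_op d d' \<Lambda> \<Longrightarrow> noisy_op d' d'' \<Phi> \<Longrightarrow> noisy_op d d'' (\<Phi> \<circ> \<Lambda>)"

definition achievable_rate :: "complex mat \<Rightarrow> complex mat \<Rightarrow> real \<Rightarrow> bool" where
  "achievable_rate \<rho> \<sigma> r \<longleftrightarrow> (\<exists>(m :: nat \<Rightarrow> nat) \<Lambda>.
     (\<lambda>n. real (m n) / real n) \<longlonglongrightarrow> r \<and>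
     (\<forall>n. noisy_op (dim_row \<rho> ^ n) (dim_row \<sigma> ^ m n) (\<Lambda> n)) \<and>
     (\<lambda>n. trace_norm (\<Lambda> n (tensor_pow \<rho> n) - tensor_pow \<sigma> (m n))) \<longlonglongrightarrow> 0)"

text \<open>The supremum is taken in the extended reals, where it is not a default value when the set
  of achievable rates is unbounded.\<close>

definition optimal_rate :: "complex mat \<Rightarrow> complex mat \<Rightarrow> ereal" where
  "optimal_rate \<rho> \<sigma> = Sup (ereal ` {r. achievable_rate \<rho> \<sigma> r})"

end

(*
  Both directions are one-shot estimates combined with the weak law of large numbers for
  log-probabilities (Chebyshev applied to the additive variance of the information content).

  Converse: in the Heisenberg picture a noisy operation from dimension d to dimension D maps a test
  0 <= Q' <= 1 to a test 0 <= Q <= 1 with Tr Q / d = Tr Q' / D.  Pulling back the projection onto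
  the typical subspace of the target, of rank about 2^(m S(sigma)), gives a test that nearly accepts
  n copies of the source and has trace about 2^(n N + m S(sigma) - m N').  Such a test must have
  trace at least about 2^(n S(rho)).  No continuity of the entropy is needed.

  Achievability: after an ancilla of dimension K every eigenvalue p_i of the source is split into K
  equal pieces.  A permutation groups the pieces into D groups of equal size, and discarding
  sums each group.  Sending about K q_j pieces of every typical p_i to group j yields
  approximately the target spectrum q; there is room for this as long as the number of typical i,
  times q_j, is at most d / D, which is the condition on the rate.
*)
theory Submission
  imports Defs "Jordan_Normal_Form.Spectral_Radius"
begin

subsection \<open>Unitary diagonalization of Hermitian matrices\<close>

text \<open>Entropy and trace norm can be evaluated only through a diagonalization, so every
  operator of interest is kept in the form \<open>udiag d U f\<close>, and operations are shown to
  preserve hermiticity before the trace norm of an output error is estimated. Typicality is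
  one-sided. The converse caps the source eigenvalues from above and bounds the target eigenvalues
  from below, in order to count them; the construction does the reverse. Each of the two bounds
  costs a factor \<open>2 powr t\<close>, hence the \<open>2 * t\<close> in both exponents. With
  \<open>t = \<delta> * n\<close> the Chebyshev error is of order
  \<open>1 / (\<delta>\<^sup>2 * n)\<close> and vanishes, while the cost per copy is
  \<open>2 * \<delta>\<close>, which is as small as desired. The positive slack \<delta> confines
  the construction to rates strictly below the quotient; the supremum absorbs this. For a maximally
  mixed source no nonnegative rate lies strictly below, so rate 0 is built separately.\<close>

lemma sum_prod_index:
  fixes f :: "nat \<Rightarrow> 'a::comm_monoid_add"
  shows "(\<Sum>x<a * b. f x) = (\<Sum>i<a. \<Sum>k<b. f (i * b + k))"
proof -
  have "sum f {i * b..<i * b + b} = (\<Sum>k<b. f (i * b + k))" for i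
    using sum.shift_bounds_nat_ivl[of f 0 "i * b" b] by (simp add: add.commute lessThan_atLeast0)
  then show ?thesis
    using sum.nat_group[of f b a] by simp
qed

lemma pair_index_less: "i < a \<Longrightarrow> k < b \<Longrightarrow> i * b + k < a * (b::nat)"
  by (metis add_less_mono1 less_le_trans mult_Suc add.commute mult_le_mono1 Suc_leI)

lemma dim_adjoint [simp]:
  "dim_row (mat_adjoint (A :: complex mat)) = dim_col A"
  "dim_col (mat_adjoint (A :: complex mat)) = dim_row A"
  by (auto simp: mat_adjoint_def)

lemma index_adjoint [simp]:
  "i < dim_col A \<Longrightarrow> j < dim_row A \<Longrightarrow> mat_adjoint (A :: complex mat) $$ (i, j) = cnj (A $$ (j, i))"
  by (simp add: mat_adjoint_def mat_of_rows_index)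

lemma index_mult_sum:
  "A \<in> carrier_mat n m \<Longrightarrow> B \<in> carrier_mat m k \<Longrightarrow> i < n \<Longrightarrow> j < k \<Longrightarrow>
    (A * B) $$ (i, j) = (\<Sum>l<m. A $$ (i, l) * B $$ (l, j))"
  by (auto simp: scalar_prod_def lessThan_atLeast0 intro!: sum.cong)

lemma mult_square_carrier [simp]:
  "A \<in> carrier_mat n n \<Longrightarrow> B \<in> carrier_mat n n \<Longrightarrow> A * B \<in> carrier_mat n n"
  by (rule mult_carrier_mat)

lemma adjoint_adjoint [simp]: "mat_adjoint (mat_adjoint A) = (A :: complex mat)"
  by (intro eq_matI) auto

lemma adjoint_mult:
  assumes "A \<in> carrier_mat n m" "B \<in> carrier_mat m k"
  shows "mat_adjoint (A * B) = mat_adjoint B * mat_adjoint (A :: complex mat)"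
proof (rule eq_matI)
  fix i j assume "i < dim_row (mat_adjoint B * mat_adjoint A)" "j < dim_col (mat_adjoint B * mat_adjoint A)"
  with assms have ij: "i < k" "j < n" by auto
  have "(mat_adjoint B * mat_adjoint A) $$ (i, j) = (\<Sum>l<m. mat_adjoint B $$ (i, l) * mat_adjoint A $$ (l, j))"
    using assms ij by (intro index_mult_sum) auto
  also have "\<dots> = cnj (\<Sum>l<m. A $$ (j, l) * B $$ (l, i))"
    using assms ij by (auto simp: cnj_sum mult.commute intro!: sum.cong)
  also have "\<dots> = mat_adjoint (A * B) $$ (i, j)"
    using assms ij by (simp add: index_mult_sum[OF assms] del: index_mult_mat(1))
  finally show "mat_adjoint (A * B) $$ (i, j) = (mat_adjoint B * mat_adjoint A) $$ (i, j)" by simp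
qed (use assms in auto)

lemma adjoint_one [simp]: "mat_adjoint (1\<^sub>m n) = (1\<^sub>m n :: complex mat)"
  by (intro eq_matI) auto

lemma unitary_mat_carrier: "unitary_mat d U \<Longrightarrow> U \<in> carrier_mat d d"
  by (simp add: unitary_mat_def)

lemma unitary_mat_iff:
  "unitary_mat d U \<longleftrightarrow> U \<in> carrier_mat d d \<and>
    (\<forall>i<d. \<forall>j<d. (\<Sum>k<d. cnj (U $$ (k, i)) * U $$ (k, j)) = (if i = j then 1 else 0))"
proof (cases "U \<in> carrier_mat d d")
  case True
  have *: "(mat_adjoint U * U) $$ (i, j) = (\<Sum>k<d. cnj (U $$ (k, i)) * U $$ (k, j))"
    if "i < d" "j < d" for i j
    using True that by (subst index_mult_sum[of _ d d _ d]) auto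
  show ?thesis
  proof
    assume "unitary_mat d U"
    then have "mat_adjoint U * U = 1\<^sub>m d" by (simp add: unitary_mat_def)
    then show "U \<in> carrier_mat d d \<and>
      (\<forall>i<d. \<forall>j<d. (\<Sum>k<d. cnj (U $$ (k, i)) * U $$ (k, j)) = (if i = j then 1 else 0))"
      using * True by (metis index_one_mat(1))
  next
    assume r: "U \<in> carrier_mat d d \<and>
      (\<forall>i<d. \<forall>j<d. (\<Sum>k<d. cnj (U $$ (k, i)) * U $$ (k, j)) = (if i = j then 1 else 0))"
    have "mat_adjoint U * U = 1\<^sub>m d"
    proof (rule eq_matI)
      fix i j assume "i < dim_row (1\<^sub>m d :: complex mat)" "j < dim_col (1\<^sub>m d :: complex mat)"
      then have ij: "i < d" "j < d" by auto
      then show "(mat_adjoint U * U) $$ (i, j) = 1\<^sub>m d $$ (i, j)"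
        using r unfolding *[OF ij] by simp
    qed (use True in auto)
    then show "unitary_mat d U" using True by (simp add: unitary_mat_def)
  qed
qed (simp add: unitary_mat_def)

lemma unitary_mat_cols:
  "unitary_mat d U \<Longrightarrow> i < d \<Longrightarrow> j < d \<Longrightarrow>
    (\<Sum>k<d. cnj (U $$ (k, i)) * U $$ (k, j)) = (if i = j then 1 else 0)"
  by (simp add: unitary_mat_iff)

lemma unitary_mat_adjoint: "unitary_mat d U \<Longrightarrow> unitary_mat d (mat_adjoint U)"
  using unitary_mat_right by (simp add: unitary_mat_def)

lemma unitary_mat_rows:
  assumes "unitary_mat d U" "i < d" "j < d"
  shows "(\<Sum>k<d. U $$ (i, k) * cnj (U $$ (j, k))) = (if i = j then 1 else 0)"
proof -
  have "U \<in> carrier_mat d d" using assms(1) by (rule unitary_mat_carrier)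
  then show ?thesis
    using unitary_mat_cols[OF unitary_mat_adjoint[OF assms(1)] assms(2,3)] assms(2,3) by simp
qed

lemma unitary_mat_one: "unitary_mat d (1\<^sub>m d)"
  by (simp add: unitary_mat_def)

lemma unitary_mat_mult:
  assumes U: "unitary_mat d U" and V: "unitary_mat d V"
  shows "unitary_mat d (U * V)"
proof -
  have [simp]: "U \<in> carrier_mat d d" "V \<in> carrier_mat d d" using U V by (auto simp: unitary_mat_carrier)
  have "mat_adjoint (U * V) * (U * V) = mat_adjoint V * mat_adjoint U * (U * V)"
    by (simp add: adjoint_mult[of U d d V d])
  also have "\<dots> = mat_adjoint V * (mat_adjoint U * (U * V))"
    by (rule assoc_mult_mat[of _ d d _ d _ d]) auto
  also have "mat_adjoint U * (U * V) = mat_adjoint U * U * V"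
    by (rule assoc_mult_mat[symmetric, of _ d d _ d _ d]) auto
  also have "\<dots> = V" using U left_mult_one_mat[of V d d] by (simp add: unitary_mat_def)
  finally show ?thesis using V by (simp add: unitary_mat_def)
qed

declare unitary_mat_carrier [simp]

definition hermitian :: "nat \<Rightarrow> complex mat \<Rightarrow> bool" where
  "hermitian d A \<longleftrightarrow> A \<in> carrier_mat d d \<and> (\<forall>i<d. \<forall>j<d. A $$ (i, j) = cnj (A $$ (j, i)))"

text \<open>The function \<open>f\<close> lists real eigenvalues, so such matrices are Hermitian;
  only its values below \<open>d\<close> matter.\<close>

definition udiag :: "nat \<Rightarrow> complex mat \<Rightarrow> (nat \<Rightarrow> real) \<Rightarrow> complex mat" where
  "udiag d U f = U * mat_diag d (\<lambda>i. of_real (f i)) * mat_adjoint U"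

lemma udiag_carrier [simp]: "U \<in> carrier_mat d d \<Longrightarrow> udiag d U f \<in> carrier_mat d d"
  unfolding udiag_def by (intro mult_carrier_mat[of _ d d]) auto

lemma udiag_dim [simp]:
  "U \<in> carrier_mat d d \<Longrightarrow> dim_row (udiag d U f) = d"
  "U \<in> carrier_mat d d \<Longrightarrow> dim_col (udiag d U f) = d"
  using udiag_carrier by blast+

lemma index_udiag:
  assumes "U \<in> carrier_mat d d" "i < d" "j < d"
  shows "udiag d U f $$ (i, j) = (\<Sum>l<d. U $$ (i, l) * of_real (f l) * cnj (U $$ (j, l)))"
  unfolding udiag_def using assms
  by (subst index_mult_sum[of _ d d _ d]) (auto simp: mat_diag_mult_right[of _ d d])

lemma hermitian_adjoint: "hermitian d A \<longleftrightarrow> A \<in> carrier_mat d d \<and> mat_adjoint A = A"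
proof (cases "A \<in> carrier_mat d d")
  case True
  show ?thesis
  proof
    assume h: "hermitian d A"
    have "mat_adjoint A = A"
    proof (rule eq_matI)
      fix i j assume "i < dim_row A" "j < dim_col A"
      then have ij: "i < d" "j < d" using True by auto
      then have "A $$ (i, j) = cnj (A $$ (j, i))" using h unfolding hermitian_def by blast
      then show "mat_adjoint A $$ (i, j) = A $$ (i, j)" using ij True by simp
    qed (use True in auto)
    with True show "A \<in> carrier_mat d d \<and> mat_adjoint A = A" by simp
  next
    assume a: "A \<in> carrier_mat d d \<and> mat_adjoint A = A"
    show "hermitian d A" unfolding hermitian_def
    proof (intro conjI allI impI)
      fix i j assume "i < d" "j < d"
      then have "mat_adjoint A $$ (i, j) = cnj (A $$ (j, i))" using True by simp
      then show "A $$ (i, j) = cnj (A $$ (j, i))" using a by simp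
    qed (use True in simp)
  qed
qed (simp add: hermitian_def)

lemma hermitian_conj:
  assumes h: "hermitian d A" and W: "W \<in> carrier_mat d' d"
  shows "hermitian d' (W * A * mat_adjoint W)"
proof -
  have A: "A \<in> carrier_mat d d" "mat_adjoint A = A" using h by (auto simp: hermitian_adjoint)
  have W': "mat_adjoint W \<in> carrier_mat d d'" using W by simp
  have "mat_adjoint (W * A * mat_adjoint W) = W * (A * mat_adjoint W)"
    using A W W' adjoint_mult[of "W * A" d' d "mat_adjoint W" d'] adjoint_mult[of W d' d A d] by simp
  also have "\<dots> = W * A * mat_adjoint W"
    using assoc_mult_mat[OF W A(1) W'] by simp
  finally show ?thesis unfolding hermitian_adjoint
    using assoc_mult_mat[OF W A(1) W'] mult_carrier_mat[OF W mult_carrier_mat[OF A(1) W']] by simp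
qed

text \<open>Gram-Schmidt, started from a basis with head \<open>v\<close>, leaves the head in place;
  dividing by the norms makes the family orthonormal. The factor \<open>c\<close> is the inverse
  norm of \<open>v\<close>.\<close>

lemma unitary_first_column:
  assumes v: "v \<in> carrier_vec n" "v \<noteq> 0\<^sub>v n"
  obtains W c where "unitary_mat n W" "\<And>i. i < n \<Longrightarrow> W $$ (i, 0) = c * v $ i"
proof -
  interpret cof_vec_space n "TYPE(complex)" .
  define b where "b = basis_completion v"
  define ws where "ws = gram_schmidt n b"
  note bc = basis_completion[OF v, folded b_def]
  have n: "n \<noteq> 0" using v by auto
  obtain vs where bv: "b = v # vs" using bc n by (cases b) auto
  have ws: "set ws \<subseteq> carrier_vec n" "corthogonal ws" "length ws = n"
    using gram_schmidt_result[OF bc(2,4,5) refl, folded ws_def] bc(6) by auto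
  have hd: "hd ws = v" unfolding ws_def bv using v by simp
  then have ws0: "ws ! 0 = v" using ws n by (metis hd_conv_nth length_0_conv)
  have car: "ws ! i \<in> carrier_vec n" if "i < n" for i using ws that by auto
  define s where "s i = (\<Sum>k<n. (cmod (ws ! i $ k))\<^sup>2)" for i
  have sp: "ws ! j \<bullet>c ws ! i = (\<Sum>k<n. cnj (ws ! i $ k) * ws ! j $ k)" if "i < n" "j < n" for i j
    using car[OF that(1)] car[OF that(2)]
    by (auto simp: scalar_prod_def lessThan_atLeast0 mult.commute intro!: sum.cong)
  have ss: "(\<Sum>k<n. cnj (ws ! i $ k) * ws ! i $ k) = of_real (s i)" for i
    unfolding s_def of_real_sum
    by (intro sum.cong refl) (metis complex_norm_square mult.commute)
  \<comment> \<open>\<open>corthogonal\<close> includes that no member is orthogonal to itself, so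
    no norm vanishes.\<close>
  have s0: "s i \<noteq> 0" if "i < n" for i
  proof -
    have "ws ! i \<bullet>c ws ! i \<noteq> 0" using corthogonalD[OF ws(2), of i i] that ws(3) by simp
    then show ?thesis using sp[OF that that] ss[of i] by auto
  qed
  have s_pos: "s i > 0" if "i < n" for i
  proof -
    have "s i \<ge> 0" unfolding s_def by (intro sum_nonneg) simp
    with s0[OF that] show ?thesis by linarith
  qed
  define W where "W = mat n n (\<lambda>(i, j). ws ! j $ i / of_real (sqrt (s j)))"
  have "unitary_mat n W"
    unfolding unitary_mat_iff
  proof (intro conjI allI impI)
    fix i j assume ij: "i < n" "j < n"
    have "(\<Sum>k<n. cnj (W $$ (k, i)) * W $$ (k, j))
      = (\<Sum>k<n. cnj (ws ! i $ k) * ws ! j $ k) / (of_real (sqrt (s i)) * of_real (sqrt (s j)))"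
      unfolding sum_divide_distrib using ij by (intro sum.cong) (auto simp: W_def)
    also have "\<dots> = (if i = j then 1 else 0)"
    proof (cases "i = j")
      case True
      have "of_real (sqrt (s i)) * of_real (sqrt (s i)) = (of_real (s i) :: complex)"
        using s_pos[OF ij(1)] by (simp flip: of_real_mult)
      then show ?thesis using True ss[of i] s0[OF ij(1)] by simp
    next
      case False
      then have "ws ! j \<bullet>c ws ! i = 0" using corthogonalD[OF ws(2), of j i] ij ws(3) by auto
      then show ?thesis using False sp[OF ij] by simp
    qed
    finally show "(\<Sum>k<n. cnj (W $$ (k, i)) * W $$ (k, j)) = (if i = j then 1 else 0)" .
  qed (simp add: W_def)
  moreover have "W $$ (i, 0) = (1 / of_real (sqrt (s 0))) * v $ i" if "i < n" for i
    using that n by (simp add: W_def ws0)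
  ultimately show ?thesis by (rule that)
qed

lemma udiag_conj:
  assumes "U \<in> carrier_mat d d" "W \<in> carrier_mat d d"
  shows "W * udiag d U f * mat_adjoint W = udiag d (W * U) f"
proof -
  let ?D = "mat_diag d (\<lambda>i. complex_of_real (f i))"
  have "W * (U * ?D * mat_adjoint U) * mat_adjoint W = W * U * ?D * (mat_adjoint U * mat_adjoint W)"
    using assms by (simp add: assoc_mult_mat[of _ d d _ d _ d] mult_carrier_mat[of _ d d _ d])
  then show ?thesis using assms by (simp add: udiag_def adjoint_mult[of W d d U d])
qed

text \<open>Deflation, by induction on the dimension: an eigenvector turned into the first basis
  vector clears the rest of the first column, hermiticity clears the rest of the first row, and the
  remaining block is diagonalized by induction.\<close>

theorem hermitian_diagonalization:
  assumes "hermitian n A"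
  obtains U e where "unitary_mat n U" "A = udiag n U e"
proof -
  have "\<exists>U e. unitary_mat n U \<and> A = udiag n U e"
    using assms
  proof (induction n arbitrary: A)
    case 0
    then show ?case
      by (intro exI[of _ "1\<^sub>m 0"] exI[of _ "\<lambda>_. 0"] conjI unitary_mat_one eq_matI)
        (auto simp: hermitian_def)
  next
    case (Suc n)
    let ?n = "Suc n"
    have A [simp]: "A \<in> carrier_mat ?n ?n" using Suc.prems by (simp add: hermitian_def)
    obtain e0 where "e0 \<in> spectrum A" using spectrum_non_empty[OF A] by auto
    then obtain v where ev: "v \<in> carrier_vec ?n" "v \<noteq> 0\<^sub>v ?n" "A *\<^sub>v v = e0 \<cdot>\<^sub>v v"
      using A by (auto simp: spectrum_def eigenvalue_def eigenvector_def)
    obtain W c where W: "unitary_mat ?n W" and W0: "\<And>i. i < ?n \<Longrightarrow> W $$ (i, 0) = c * v $ i"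
      using unitary_first_column[OF ev(1,2)] by blast
    have Wc [simp]: "W \<in> carrier_mat ?n ?n" using W by simp
    define A' where "A' = mat_adjoint W * A * W"
    have hA': "hermitian ?n A'"
      using hermitian_conj[OF Suc.prems, of "mat_adjoint W" ?n] by (simp add: A'_def)
    then have A' [simp]: "A' \<in> carrier_mat ?n ?n" by (simp add: hermitian_def)
    have AW: "(A * W) $$ (k, 0) = e0 * W $$ (k, 0)" if k: "k < ?n" for k
    proof -
      have "(A * W) $$ (k, 0) = c * (\<Sum>l<?n. A $$ (k, l) * v $ l)"
        using k by (subst index_mult_sum[OF A Wc]) (auto simp: W0 sum_distrib_left algebra_simps simp del: sum.lessThan_Suc intro!: sum.cong)
      also have "(\<Sum>l<?n. A $$ (k, l) * v $ l) = (A *\<^sub>v v) $ k"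
        using k ev(1) carrier_matD[OF A]
        by (auto simp: mult_mat_vec_def scalar_prod_def lessThan_atLeast0 simp del: sum.lessThan_Suc
            sum.op_ivl_Suc intro!: sum.cong)
      finally show ?thesis using k ev(1,3) by (simp add: W0)
    qed
    have col0: "A' $$ (i, 0) = (if i = 0 then e0 else 0)" if i: "i < ?n" for i
    proof -
      have "A' = mat_adjoint W * (A * W)"
        unfolding A'_def by (rule assoc_mult_mat[of _ ?n ?n _ ?n _ ?n]) auto
      also have "\<dots> $$ (i, 0) = (\<Sum>k<?n. mat_adjoint W $$ (i, k) * (A * W) $$ (k, 0))"
        using i by (intro index_mult_sum[of _ _ ?n _ ?n]) (auto intro: mult_carrier_mat[OF A Wc])
      also have "\<dots> = e0 * (\<Sum>k<?n. cnj (W $$ (k, i)) * W $$ (k, 0))"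
        unfolding sum_distrib_left using i carrier_matD[OF Wc]
        by (intro sum.cong) (auto simp: AW simp del: index_mult_mat(1))
      finally show ?thesis using unitary_mat_cols[OF W i, of 0] by simp
    qed
    have row0: "A' $$ (0, j) = (if j = 0 then e0 else 0)" if "j < ?n" for j
      using hA' that col0[OF that] col0[of 0] unfolding hermitian_def
      by (cases "j = 0") (metis, metis complex_cnj_zero zero_less_Suc)
    \<comment> \<open>The eigenvalue is a diagonal entry of a Hermitian matrix, hence real, as
      \<open>udiag\<close> requires.\<close>
    have e0: "e0 = of_real (Re e0)"
      using hA' col0[of 0] unfolding hermitian_def
      by (metis Reals_cnj_iff of_real_Re zero_less_Suc)
    define A3 where "A3 = mat n n (\<lambda>(i, j). A' $$ (Suc i, Suc j))"
    have "hermitian n A3"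
      unfolding hermitian_def
    proof (intro conjI allI impI)
      fix i j assume "i < n" "j < n"
      moreover from this have "A' $$ (Suc i, Suc j) = cnj (A' $$ (Suc j, Suc i))"
        using hA' unfolding hermitian_def by blast
      ultimately show "A3 $$ (i, j) = cnj (A3 $$ (j, i))" by (simp add: A3_def)
    qed (simp add: A3_def)
    then obtain U3 e where U3: "unitary_mat n U3" and A3: "A3 = udiag n U3 e"
      using Suc.IH by blast
    have U3c: "U3 \<in> carrier_mat n n" using U3 by simp
    \<comment> \<open>\<open>V\<close> is block diagonal with blocks 1 and
      \<open>U3\<close>.\<close>
    define V where "V = mat ?n ?n (\<lambda>(i, j). case (i, j) of (Suc i', Suc j') \<Rightarrow> U3 $$ (i', j')
      | _ \<Rightarrow> if i = j then 1 else (0 :: complex))"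
    have Vi: "V $$ (0, 0) = 1" "\<And>i. i < n \<Longrightarrow> V $$ (0, Suc i) = 0" "\<And>i. i < n \<Longrightarrow> V $$ (Suc i, 0) = 0"
      "\<And>i j. i < n \<Longrightarrow> j < n \<Longrightarrow> V $$ (Suc i, Suc j) = U3 $$ (i, j)"
      by (auto simp: V_def)
    have V: "unitary_mat ?n V"
      unfolding unitary_mat_iff
    proof (intro conjI allI impI)
      fix i j assume "i < ?n" "j < ?n"
      then show "(\<Sum>k<?n. cnj (V $$ (k, i)) * V $$ (k, j)) = (if i = j then 1 else 0)"
        using unitary_mat_cols[OF U3]
        by (cases i; cases j) (auto simp: sum.lessThan_Suc_shift Vi simp del: sum.lessThan_Suc)
    qed (simp add: V_def)
    have Vc: "V \<in> carrier_mat ?n ?n" using V by simp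
    let ?e = "case_nat (Re e0) e"
    have "A' = udiag ?n V ?e"
    proof (rule eq_matI)
      fix i j assume "i < dim_row (udiag ?n V ?e)" "j < dim_col (udiag ?n V ?e)"
      then have ij: "i < ?n" "j < ?n" using Vc by auto
      have A3i: "A' $$ (Suc i', Suc j') = (\<Sum>l<n. U3 $$ (i', l) * of_real (e l) * cnj (U3 $$ (j', l)))"
        if "i' < n" "j' < n" for i' j'
        using index_udiag[OF U3c that, of e] that unfolding A3[symmetric] by (simp add: A3_def)
      show "A' $$ (i, j) = udiag ?n V ?e $$ (i, j)"
        using ij e0 row0[of j] col0[of i] unfolding index_udiag[OF Vc ij]
        by (cases i; cases j) (auto simp: sum.lessThan_Suc_shift Vi A3i simp del: sum.lessThan_Suc)
    qed (use Vc carrier_matD[OF A'] in auto)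
    then have "W * A' * mat_adjoint W = udiag ?n (W * V) ?e"
      using udiag_conj[OF Vc Wc] by simp
    moreover have "W * A' * mat_adjoint W = A"
    proof -
      note assoc = assoc_mult_mat[of _ ?n ?n _ ?n _ ?n]
      have c: "X * Y \<in> carrier_mat ?n ?n"
        if "X \<in> carrier_mat ?n ?n" "Y \<in> carrier_mat ?n ?n" for X Y :: "complex mat"
        using that by (rule mult_carrier_mat)
      have "W * A' * mat_adjoint W = (W * mat_adjoint W) * A * (W * mat_adjoint W)"
        by (simp add: A'_def assoc c)
      then show ?thesis
        using unitary_mat_right[OF W] left_mult_one_mat[OF A] right_mult_one_mat[OF A] by simp
    qed
    ultimately show ?case using unitary_mat_mult[OF W V] by metis
  qed
  then show ?thesis using that by blast
qed


section \<open>Functional calculus, entropy and trace norm in diagonalized form\<close>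

lemma trace_udiag:
  assumes "unitary_mat d U"
  shows "mat_trace (udiag d U f) = of_real (\<Sum>i<d. f i)"
proof -
  have U: "U \<in> carrier_mat d d" using assms by simp
  have "mat_trace (udiag d U f) = (\<Sum>i<d. \<Sum>l<d. U $$ (i, l) * of_real (f l) * cnj (U $$ (i, l)))"
    using U by (auto simp: mat_trace_def index_udiag intro!: sum.cong)
  also have "\<dots> = (\<Sum>l<d. of_real (f l) * (\<Sum>i<d. cnj (U $$ (i, l)) * U $$ (i, l)))"
    by (subst sum.swap) (simp add: sum_distrib_left mult_ac)
  also have "\<dots> = (\<Sum>l<d. of_real (f l))"
    using unitary_mat_cols[OF assms] by (intro sum.cong) auto
  finally show ?thesis by simp
qed

lemma udiag_mult:
  assumes "unitary_mat d U"
  shows "udiag d U f * udiag d U g = udiag d U (\<lambda>i. f i * g i)"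
proof -
  have U [simp]: "U \<in> carrier_mat d d" using assms by simp
  note assoc = assoc_mult_mat[of _ d d _ d _ d]
  let ?f = "mat_diag d (\<lambda>i. complex_of_real (f i))" and ?g = "mat_diag d (\<lambda>i. complex_of_real (g i))"
  have "udiag d U f * udiag d U g = U * ?f * (mat_adjoint U * U) * ?g * mat_adjoint U"
    unfolding udiag_def by (simp add: assoc)
  also have "\<dots> = U * (?f * ?g) * mat_adjoint U"
    using assms right_mult_one_mat[of "U * ?f" d d] by (simp add: unitary_mat_def assoc del: mat_diag_diag)
  finally show ?thesis by (simp add: udiag_def)
qed

lemma adjoint_udiag:
  assumes "U \<in> carrier_mat d d"
  shows "mat_adjoint (udiag d U f) = udiag d U f"
proof (rule eq_matI)
  fix i j assume "i < dim_row (udiag d U f)" "j < dim_col (udiag d U f)"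
  then have ij: "i < d" "j < d" using assms by auto
  then have "mat_adjoint (udiag d U f) $$ (i, j) = cnj (udiag d U f $$ (j, i))"
    using assms by simp
  also have "\<dots> = udiag d U f $$ (i, j)"
    using assms ij by (auto simp: index_udiag mult_ac intro!: sum.cong)
  finally show "mat_adjoint (udiag d U f) $$ (i, j) = udiag d U f $$ (i, j)" .
qed (use assms in auto)

lemma udiag_diff:
  assumes "U \<in> carrier_mat d d"
  shows "udiag d U f - udiag d U g = udiag d U (\<lambda>i. f i - g i)"
  using assms by (intro eq_matI) (auto simp: index_udiag sum_subtractf algebra_simps)

lemma udiag_one:
  assumes "unitary_mat d U"
  shows "udiag d U (\<lambda>_. 1) = 1\<^sub>m d"
proof -
  have "udiag d U (\<lambda>_. 1) = U * 1\<^sub>m d * mat_adjoint U" by (simp add: udiag_def)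
  also have "\<dots> = U * mat_adjoint U"
    using right_mult_one_mat[OF unitary_mat_carrier[OF assms]] by simp
  finally show ?thesis using unitary_mat_right[OF assms] by simp
qed

lemma mat_fun_udiag:
  assumes "unitary_mat d U"
  shows "mat_fun f (udiag d U e) = udiag d U (\<lambda>i. f (e i))"
proof (rule mat_fun_eq)
  have "dim_row (udiag d U e) = d" using assms by simp
  then show "is_mat_fun f (udiag d U e) (udiag d U (\<lambda>i. f (e i)))"
    unfolding is_mat_fun_def using assms
    by (intro exI[of _ U] exI[of _ e]) (simp add: udiag_def)
qed

lemma entropy_udiag:
  "unitary_mat d U \<Longrightarrow> entropy (udiag d U p) = - (\<Sum>i<d. p i * log 2 (p i))"
  unfolding entropy_def by (simp add: mat_fun_udiag udiag_mult trace_udiag)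

text \<open>The product of the adjoint with the matrix has eigenvalues \<open>f i * f i\<close>,
  whose square roots are the absolute values.\<close>

lemma trace_norm_udiag:
  "unitary_mat d U \<Longrightarrow> trace_norm (udiag d U f) = (\<Sum>i<d. \<bar>f i\<bar>)"
  unfolding trace_norm_def by (simp add: mat_fun_udiag udiag_mult trace_udiag adjoint_udiag)

text \<open>Vectors are plain functions, cut off by the sums, so that columns of a unitary or slices
  of a tensor index can be inserted without carrier conditions.\<close>

definition quad_form :: "nat \<Rightarrow> complex mat \<Rightarrow> (nat \<Rightarrow> complex) \<Rightarrow> complex" where
  "quad_form d A v = (\<Sum>i<d. cnj (v i) * (\<Sum>j<d. A $$ (i, j) * v j))"

lemma quad_form_vec:
  assumes "A \<in> carrier_mat d d"
  shows "(A *\<^sub>v vec d v) \<bullet>c vec d v = quad_form d A v"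
  using assms unfolding quad_form_def
  by (auto simp: scalar_prod_def lessThan_atLeast0 mult_ac intro!: sum.cong)

lemma psd_mat_quad_form: "psd_mat d A \<Longrightarrow> 0 \<le> quad_form d A v"
  unfolding psd_mat_def using quad_form_vec[of A d v] vec_carrier[of d v] by metis

lemma quad_form_two:
  assumes "i < d" "j < d"
  shows "quad_form d A (\<lambda>k. (if k = i then 1 else 0) + (if k = j then c else 0))
    = A $$ (i, i) + c * A $$ (i, j) + cnj c * A $$ (j, i) + cnj c * c * A $$ (j, j)"
proof -
  have inner: "(\<Sum>l<d. A $$ (k, l) * ((if l = i then 1 else 0) + (if l = j then c else 0)))
    = A $$ (k, i) + A $$ (k, j) * c" for k
    using assms by (simp add: distrib_left sum.distrib if_distrib[of "(*) _"] cong: if_cong)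
  have cnjs: "cnj ((if k = i then 1 else 0) + (if k = j then c else 0))
    = (if k = i then 1 else 0) + (if k = j then cnj c else 0)" for k by simp
  show ?thesis
    unfolding quad_form_def inner cnjs using assms
    by (simp add: distrib_right sum.distrib if_distrib[of "\<lambda>x. x * _"] cong: if_cong)
      (simp add: algebra_simps)
qed

lemma nonneg_Im: "0 \<le> (z :: complex) \<Longrightarrow> Im z = 0"
  by (simp add: less_eq_complex_def)

text \<open>Polarization: the form is real at basis vector \<open>i\<close> plus \<open>c\<close>
  times basis vector \<open>j\<close>, and taking the four fourth roots of unity for
  \<open>c\<close> determines the real and the imaginary parts of the off-diagonal entries.\<close>

lemma psd_mat_hermitian:
  assumes "psd_mat d A"
  shows "hermitian d A"
  unfolding hermitian_def
proof (intro conjI allI impI)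
  fix i j assume ij: "i < d" "j < d"
  have real: "Im (A $$ (i, i) + c * A $$ (i, j) + cnj c * A $$ (j, i) + cnj c * c * A $$ (j, j)) = 0" for c
    by (rule nonneg_Im) (use psd_mat_quad_form[OF assms] in \<open>simp only: quad_form_two[OF ij, symmetric]\<close>)
  have "Im (A $$ (i, i)) + (Im (A $$ (i, j)) + Im (A $$ (j, i))) + Im (A $$ (j, j)) = 0"
    "Im (A $$ (i, i)) - (Im (A $$ (i, j)) + Im (A $$ (j, i))) + Im (A $$ (j, j)) = 0"
    "Im (A $$ (i, i)) + (Re (A $$ (i, j)) - Re (A $$ (j, i))) + Im (A $$ (j, j)) = 0"
    "Im (A $$ (i, i)) - (Re (A $$ (i, j)) - Re (A $$ (j, i))) + Im (A $$ (j, j)) = 0"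
    using real[of 1] real[of "-1"] real[of \<i>] real[of "-\<i>"] by simp_all
  then have "Re (A $$ (i, j)) = Re (A $$ (j, i))" "Im (A $$ (i, j)) = - Im (A $$ (j, i))"
    by linarith+
  then show "A $$ (i, j) = cnj (A $$ (j, i))" by (simp add: complex_eq_iff)
qed (use assms in \<open>simp add: psd_mat_def\<close>)

lemma cnj_mult_self: "cnj z * z = of_real ((cmod z)\<^sup>2)"
  by (metis complex_norm_square mult.commute)

text \<open>Each eigenvalue is weighted by the squared overlap of \<open>v\<close> with its
  eigenvector, which reduces positivity and comparison of forms to the eigenvalues.\<close>

lemma quad_form_udiag:
  assumes "U \<in> carrier_mat d d"
  shows "quad_form d (udiag d U f) v
    = of_real (\<Sum>l<d. f l * (cmod (\<Sum>i<d. cnj (U $$ (i, l)) * v i))\<^sup>2)"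
proof -
  let ?s = "\<lambda>l. \<Sum>i<d. cnj (U $$ (i, l)) * v i"
  have "quad_form d (udiag d U f) v
    = (\<Sum>i<d. \<Sum>j<d. \<Sum>l<d. cnj (v i) * U $$ (i, l) * of_real (f l) * (cnj (U $$ (j, l)) * v j))"
    using assms by (auto simp: quad_form_def index_udiag sum_distrib_left sum_distrib_right mult_ac intro!: sum.cong)
  also have "\<dots> = (\<Sum>i<d. \<Sum>l<d. cnj (v i) * U $$ (i, l) * of_real (f l) * ?s l)"
    by (subst sum.swap) (simp add: sum_distrib_left)
  also have "\<dots> = (\<Sum>l<d. of_real (f l) * (cnj (?s l) * ?s l))"
    by (subst sum.swap) (simp add: sum_distrib_left sum_distrib_right mult_ac)
  also have "\<dots> = (\<Sum>l<d. of_real (f l * (cmod (?s l))\<^sup>2))"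
    by (simp only: cnj_mult_self of_real_mult)
  finally show ?thesis by (simp only: of_real_sum)
qed

lemma quad_form_udiag_col:
  assumes U: "unitary_mat d U" and m: "m < d"
  shows "quad_form d (udiag d U f) (\<lambda>k. U $$ (k, m)) = of_real (f m)"
proof -
  have "(\<Sum>l<d. f l * (cmod (\<Sum>i<d. cnj (U $$ (i, l)) * U $$ (i, m)))\<^sup>2) = (\<Sum>l<d. if l = m then f l else 0)"
    using unitary_mat_cols[OF U _ m] by (intro sum.cong) auto
  then show ?thesis using U m by (simp add: quad_form_udiag)
qed

text \<open>Positivity of the form at the columns of \<open>U\<close> and the trace condition make
  the spectrum a probability distribution.\<close>

lemma state_diagonalization:
  assumes "state d \<rho>"
  obtains U p where "unitary_mat d U" "\<rho> = udiag d U p" "\<And>i. i < d \<Longrightarrow> 0 \<le> p i" "(\<Sum>i<d. p i) = 1"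
proof -
  have psd: "psd_mat d \<rho>" and tr: "mat_trace \<rho> = 1" using assms by (auto simp: state_def)
  obtain U p where U: "unitary_mat d U" and \<rho>: "\<rho> = udiag d U p"
    using hermitian_diagonalization[OF psd_mat_hermitian[OF psd]] .
  have "0 \<le> p i" if "i < d" for i
    using psd_mat_quad_form[OF psd, of "\<lambda>k. U $$ (k, i)"] quad_form_udiag_col[OF U that, of p]
    unfolding \<rho> by (simp add: less_eq_complex_def)
  moreover have "(\<Sum>i<d. p i) = 1"
    using tr trace_udiag[OF U, of p] unfolding \<rho> by (metis of_real_1 of_real_eq_iff)
  ultimately show ?thesis using that U \<rho> by blast
qed

section \<open>Tensor products of diagonalized matrices\<close>

lemma tensor_mat_carrier [simp]:
  "A \<in> carrier_mat a a' \<Longrightarrow> B \<in> carrier_mat b b' \<Longrightarrow> tensor_mat A B \<in> carrier_mat (a * b) (a' * b')"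
  by (auto simp: tensor_mat_def)

lemma index_tensor_mat:
  "A \<in> carrier_mat a a' \<Longrightarrow> B \<in> carrier_mat b b' \<Longrightarrow> x < a * b \<Longrightarrow> y < a' * b' \<Longrightarrow>
    tensor_mat A B $$ (x, y) = A $$ (x div b, y div b') * B $$ (x mod b, y mod b')"
  by (auto simp: tensor_mat_def)

lemma div_mod_less_mult: "x < a * b \<Longrightarrow> x div b < a \<and> x mod b < (b::nat)"
  by (metis less_mult_imp_div_less mod_less_divisor gr0I mult_0_right not_less0)

lemma unitary_tensor_mat:
  assumes U: "unitary_mat a U" and V: "unitary_mat b V"
  shows "unitary_mat (a * b) (tensor_mat U V)"
  unfolding unitary_mat_iff
proof (intro conjI allI impI)
  have c: "U \<in> carrier_mat a a" "V \<in> carrier_mat b b" using U V by auto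
  then show "tensor_mat U V \<in> carrier_mat (a * b) (a * b)" by simp
  fix x y assume xy: "x < a * b" "y < a * b"
  have "(\<Sum>z<a * b. cnj (tensor_mat U V $$ (z, x)) * tensor_mat U V $$ (z, y))
    = (\<Sum>i<a. \<Sum>k<b. (cnj (U $$ (i, x div b)) * U $$ (i, y div b)) * (cnj (V $$ (k, x mod b)) * V $$ (k, y mod b)))"
    unfolding sum_prod_index
    using xy by (intro sum.cong refl) (simp add: index_tensor_mat[OF c] pair_index_less)
  also have "\<dots> = (\<Sum>i<a. cnj (U $$ (i, x div b)) * U $$ (i, y div b)) * (\<Sum>k<b. cnj (V $$ (k, x mod b)) * V $$ (k, y mod b))"
    by (simp add: sum_product)
  also have "\<dots> = (if x = y then 1 else 0)"
    using div_mod_less_mult[OF xy(1)] div_mod_less_mult[OF xy(2)]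
    by (auto simp: unitary_mat_cols[OF U] unitary_mat_cols[OF V]) (metis div_mod_decomp)
  finally show "(\<Sum>z<a * b. cnj (tensor_mat U V $$ (z, x)) * tensor_mat U V $$ (z, y)) = (if x = y then 1 else 0)" .
qed

lemma tensor_udiag:
  assumes c: "U \<in> carrier_mat a a" "V \<in> carrier_mat b b"
  shows "tensor_mat (udiag a U f) (udiag b V g)
    = udiag (a * b) (tensor_mat U V) (\<lambda>x. f (x div b) * g (x mod b))"
proof (rule eq_matI)
  fix x y assume "x < dim_row (udiag (a * b) (tensor_mat U V) (\<lambda>x. f (x div b) * g (x mod b)))"
    "y < dim_col (udiag (a * b) (tensor_mat U V) (\<lambda>x. f (x div b) * g (x mod b)))"
  then have xy: "x < a * b" "y < a * b" using c by auto
  note xy' = div_mod_less_mult[OF xy(1)] div_mod_less_mult[OF xy(2)]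
  have "udiag (a * b) (tensor_mat U V) (\<lambda>x. f (x div b) * g (x mod b)) $$ (x, y)
    = (\<Sum>i<a. \<Sum>k<b. (U $$ (x div b, i) * of_real (f i) * cnj (U $$ (y div b, i))) *
        (V $$ (x mod b, k) * of_real (g k) * cnj (V $$ (y mod b, k))))"
    unfolding index_udiag[OF tensor_mat_carrier[OF c] xy] sum_prod_index
    using xy by (intro sum.cong refl) (simp add: index_tensor_mat[OF c] pair_index_less mult_ac)
  also have "\<dots> = udiag a U f $$ (x div b, y div b) * udiag b V g $$ (x mod b, y mod b)"
    using xy' c by (simp add: index_udiag sum_product)
  also have "\<dots> = tensor_mat (udiag a U f) (udiag b V g) $$ (x, y)"
    using xy c by (simp add: index_tensor_mat[OF udiag_carrier udiag_carrier])
  finally show "tensor_mat (udiag a U f) (udiag b V g) $$ (x, y)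
    = udiag (a * b) (tensor_mat U V) (\<lambda>x. f (x div b) * g (x mod b)) $$ (x, y)" by simp
qed (use c tensor_mat_carrier[OF c] udiag_carrier in \<open>auto simp: tensor_mat_def\<close>)

text \<open>The index \<open>x\<close> is read as an \<open>n\<close>-digit number in base
  \<open>d\<close>, leading digit first, matching the index convention of \<open>tensor_pow\<close>;
  the value is the probability of that word under independent draws from \<open>p\<close>.\<close>

primrec prod_dist :: "nat \<Rightarrow> (nat \<Rightarrow> real) \<Rightarrow> nat \<Rightarrow> nat \<Rightarrow> real" where
  "prod_dist d p 0 x = 1"
| "prod_dist d p (Suc n) x = p (x div d ^ n) * prod_dist d p n (x mod d ^ n)"

lemma tensor_pow_udiag:
  assumes "unitary_mat d U"
  shows "unitary_mat (d ^ n) (tensor_pow U n) \<and>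
    tensor_pow (udiag d U p) n = udiag (d ^ n) (tensor_pow U n) (prod_dist d p n)"
proof (induction n)
  case 0
  show ?case using unitary_mat_one[of 1] udiag_one[OF unitary_mat_one[of 1]]
    by (simp add: udiag_def)
next
  case (Suc n)
  then show ?case
    using unitary_tensor_mat[OF assms] tensor_udiag[of U d "tensor_pow U n" "d ^ n" p "prod_dist d p n"] assms
    by simp
qed

subsection \<open>Entropy and the weak law of large numbers\<close>

lemma pair_index_div_mod: "k < b \<Longrightarrow> (i * b + k) div b = i" "k < b \<Longrightarrow> (i * b + k) mod b = (k::nat)"
  by simp_all

definition shannon :: "nat \<Rightarrow> (nat \<Rightarrow> real) \<Rightarrow> real" where
  "shannon d p = - (\<Sum>i<d. p i * log 2 (p i))"

text \<open>Gibbs' inequality against the uniform distribution, from \<open>ln y \<le> y - 1\<close>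
  at \<open>y = 1 / (d * p i)\<close>. Equality there forces \<open>y = 1\<close>, so a single entry
  other than \<open>1 / d\<close> gives strictness; this will make the denominator of the rate
  positive.\<close>

lemma shannon_le_log:
  assumes nonneg: "\<And>i. i < d \<Longrightarrow> 0 \<le> p i" and sum1: "(\<Sum>i<d. p i) = 1"
  shows "shannon d p \<le> log 2 (real d)"
    and "i < d \<Longrightarrow> p i \<noteq> 1 / real d \<Longrightarrow> shannon d p < log 2 (real d)"
proof -
  have d: "d > 0" using sum1 by (cases d) auto
  have term_le: "- (p i * ln (p i)) - p i * ln d \<le> 1 / d - p i" if "i < d" for i
  proof (cases "p i = 0")
    case False
    then have p: "p i > 0" using nonneg[OF that] by simp
    have "- (p i * ln (p i)) - p i * ln d = p i * ln (1 / (d * p i))"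
      using p d by (simp add: ln_div ln_mult algebra_simps)
    also have "\<dots> \<le> p i * (1 / (d * p i) - 1)"
      using p d by (intro mult_left_mono ln_le_minus_one) auto
    also have "\<dots> = 1 / d - p i" using p d by (simp add: field_simps)
    finally show ?thesis .
  qed simp
  have term_less: "- (p i * ln (p i)) - p i * ln d < 1 / d - p i" if "i < d" "p i \<noteq> 1 / d" for i
  proof (cases "p i = 0")
    case True then show ?thesis using d by simp
  next
    case False
    then have p: "p i > 0" using nonneg[OF that(1)] by simp
    have ne: "1 / (d * p i) \<noteq> 1" using p d that(2) by (auto simp: field_simps)
    have "- (p i * ln (p i)) - p i * ln d = p i * ln (1 / (d * p i))"
      using p d by (simp add: ln_div ln_mult algebra_simps)
    also have "ln (1 / (d * p i)) < 1 / (d * p i) - 1"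
    proof -
      have pos: "1 / (d * p i) > 0" using p d by simp
      have "ln (1 / (d * p i)) \<noteq> 1 / (d * p i) - 1" using ln_eq_minus_one[OF pos] ne by blast
      then show ?thesis using ln_le_minus_one[OF pos] by simp
    qed
    then have "p i * ln (1 / (d * p i)) < p i * (1 / (d * p i) - 1)"
      using p by (intro mult_strict_left_mono)
    also have "\<dots> = 1 / d - p i" using p d by (simp add: field_simps)
    finally show ?thesis .
  qed
  have rhs: "(\<Sum>i<d. 1 / d - p i) = 0" using d sum1 by (simp add: sum_subtractf)
  have "- (p i * log 2 (p i)) = - (p i * ln (p i)) / ln 2" for i by (simp add: log_def)
  then have sh: "shannon d p = (\<Sum>i<d. - (p i * ln (p i))) / ln 2"
    unfolding shannon_def sum_divide_distrib by (simp add: sum_negf)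
  have lhs: "(\<Sum>i<d. - (p i * ln (p i)) - p i * ln d) = (shannon d p - log 2 d) * ln 2"
    unfolding sum_subtractf sh
    by (simp add: log_def sum1 flip: sum_distrib_right) (simp add: left_diff_distrib)
  have "(\<Sum>i<d. - (p i * ln (p i)) - p i * ln d) \<le> (\<Sum>i<d. 1 / d - p i)"
    using term_le by (intro sum_mono) auto
  then have "(shannon d p - log 2 d) * ln 2 \<le> 0" unfolding lhs rhs .
  then show "shannon d p \<le> log 2 (real d)" by (simp add: mult_le_0_iff)
  assume i: "i < d" "p i \<noteq> 1 / real d"
  have "(\<Sum>i<d. - (p i * ln (p i)) - p i * ln d) < (\<Sum>i<d. 1 / d - p i)"
    using term_le term_less[OF i] i(1) by (intro sum_strict_mono_ex1) auto
  then have "(shannon d p - log 2 d) * ln 2 < 0" unfolding lhs rhs .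
  then show "shannon d p < log 2 (real d)" by (simp add: mult_less_0_iff)
qed

section \<open>Deviations of the log-probability under a product distribution\<close>

context
  fixes d :: nat and p :: "nat \<Rightarrow> real"
  assumes nonneg: "\<And>i. i < d \<Longrightarrow> 0 \<le> p i" and sum1: "(\<Sum>i<d. p i) = 1"
begin

lemma sum_prod_dist_Suc:
  "(\<Sum>x<d ^ Suc n. f x) = (\<Sum>i<d. \<Sum>x<d ^ n. f (i * d ^ n + x))"
  using sum_prod_index[of f d "d ^ n"] by simp

lemma prod_dist_Suc:
  "x < d ^ n \<Longrightarrow> prod_dist d p (Suc n) (i * d ^ n + x) = p i * prod_dist d p n x"
  by (simp only: prod_dist.simps pair_index_div_mod)

lemma prod_dist_nonneg: "x < d ^ n \<Longrightarrow> 0 \<le> prod_dist d p n x"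
proof (induction n arbitrary: x)
  case (Suc n)
  then have "x div d ^ n < d \<and> x mod d ^ n < d ^ n" using div_mod_less_mult[of x d "d ^ n"] by simp
  then show ?case using Suc.IH nonneg by simp
qed simp

lemma sum_prod_dist: "(\<Sum>x<d ^ n. prod_dist d p n x) = 1"
proof (induction n)
  case (Suc n)
  have "(\<Sum>x<d ^ Suc n. prod_dist d p (Suc n) x) = (\<Sum>i<d. \<Sum>x<d ^ n. p i * prod_dist d p n x)"
    unfolding sum_prod_dist_Suc by (intro sum.cong refl prod_dist_Suc) auto
  also have "\<dots> = (\<Sum>i<d. p i) * (\<Sum>x<d ^ n. prod_dist d p n x)" by (simp add: sum_product)
  finally show ?case using Suc sum1 by simp
qed simp

text \<open>Where \<^term>\<open>prod_dist d p n x = 0\<close> the value is junk, but it only ever occurs with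
  weight \<^term>\<open>prod_dist d p n x\<close>.\<close>

definition log_dev :: "nat \<Rightarrow> nat \<Rightarrow> real" where
  "log_dev n x = log 2 (prod_dist d p n x) + n * shannon d p"

text \<open>The variance of the information content \<open>- log 2 (p i)\<close>, whose mean under
  \<open>p\<close> is \<open>shannon d p\<close>.\<close>

definition log_var :: real where
  "log_var = (\<Sum>i<d. p i * (log 2 (p i) + shannon d p)\<^sup>2)"

text \<open>The logarithm of a product splits for positive factors only; with the convention
  \<open>log 2 0 = 0\<close> additivity may fail at zeros, hence the condition on the
  weight.\<close>

lemma log_dev_Suc:
  assumes "x < d ^ n" "p i * prod_dist d p n x \<noteq> 0" "i < d"
  shows "log_dev (Suc n) (i * d ^ n + x) = (log 2 (p i) + shannon d p) + log_dev n x"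
proof -
  have "p i > 0" "prod_dist d p n x > 0"
    using assms nonneg[of i] prod_dist_nonneg[of x n] by (auto simp: less_le)
  then have "log 2 (p i * prod_dist d p n x) = log 2 (p i) + log 2 (prod_dist d p n x)"
    by (simp add: log_mult)
  then show ?thesis unfolding log_dev_def prod_dist_Suc[OF assms(1)] by (simp add: algebra_simps)
qed

text \<open>The deviation is a sum of independent centred terms: its mean stays zero and, as the
  cross term vanishes, its second moment grows by \<open>log_var\<close> with every factor.\<close>

lemma log_dev_mean_var:
  "(\<Sum>x<d ^ n. prod_dist d p n x * log_dev n x) = 0 \<and>
   (\<Sum>x<d ^ n. prod_dist d p n x * (log_dev n x)\<^sup>2) = n * log_var"
proof (induction n)
  case 0
  show ?case by (simp add: log_dev_def)
next
  case (Suc n)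
  let ?P = "prod_dist d p n" and ?a = "\<lambda>i. log 2 (p i) + shannon d p"
  have mean_a: "(\<Sum>i<d. p i * ?a i) = 0"
  proof -
    have "(\<Sum>i<d. p i * ?a i) = (\<Sum>i<d. p i * log 2 (p i)) + (\<Sum>i<d. p i) * shannon d p"
      by (simp add: distrib_left sum.distrib sum_distrib_right)
    then show ?thesis using sum1 by (simp add: shannon_def)
  qed
  \<comment> \<open>An arbitrary \<open>g\<close> serves both moments; at weight zero both sides
    vanish, whatever the junk value of \<open>log_dev\<close>.\<close>
  have expand: "(\<Sum>x<d ^ Suc n. prod_dist d p (Suc n) x * g (log_dev (Suc n) x))
    = (\<Sum>i<d. \<Sum>x<d ^ n. p i * ?P x * g (?a i + log_dev n x))" for g :: "real \<Rightarrow> real"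
    unfolding sum_prod_dist_Suc
  proof (intro sum.cong refl)
    fix i x assume "i \<in> {..<d}" "x \<in> {..<d ^ n}"
    then show "prod_dist d p (Suc n) (i * d ^ n + x) * g (log_dev (Suc n) (i * d ^ n + x))
      = p i * ?P x * g (?a i + log_dev n x)"
      using log_dev_Suc[of x n i] by (cases "p i * ?P x = 0") (simp_all add: prod_dist_Suc del: prod_dist.simps)
  qed
  have "(\<Sum>x<d ^ Suc n. prod_dist d p (Suc n) x * log_dev (Suc n) x)
    = (\<Sum>i<d. \<Sum>x<d ^ n. p i * ?P x * (?a i + log_dev n x))"
    using expand[of "\<lambda>y. y"] .
  also have "\<dots> = (\<Sum>i<d. \<Sum>x<d ^ n. (p i * ?a i) * ?P x) + (\<Sum>i<d. \<Sum>x<d ^ n. p i * (?P x * log_dev n x))"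
    by (simp add: algebra_simps sum.distrib)
  also have "\<dots> = 0"
    using Suc mean_a by (simp add: flip: sum_product)
  finally have mean: "(\<Sum>x<d ^ Suc n. prod_dist d p (Suc n) x * log_dev (Suc n) x) = 0" .
  have "(\<Sum>x<d ^ Suc n. prod_dist d p (Suc n) x * (log_dev (Suc n) x)\<^sup>2)
    = (\<Sum>i<d. \<Sum>x<d ^ n. p i * ?P x * (?a i + log_dev n x)\<^sup>2)"
    using expand[of "\<lambda>y. y\<^sup>2"] .
  also have "\<dots> = (\<Sum>i<d. \<Sum>x<d ^ n. (p i * (?a i)\<^sup>2) * ?P x + 2 * ((p i * ?a i) * (?P x * log_dev n x))
      + p i * (?P x * (log_dev n x)\<^sup>2))"
    by (intro sum.cong refl) (simp add: power2_sum algebra_simps)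
  also have "\<dots> = (\<Sum>i<d. p i * (?a i)\<^sup>2) * (\<Sum>x<d ^ n. ?P x)
      + 2 * ((\<Sum>i<d. p i * ?a i) * (\<Sum>x<d ^ n. ?P x * log_dev n x))
      + (\<Sum>i<d. p i) * (\<Sum>x<d ^ n. ?P x * (log_dev n x)\<^sup>2)"
    unfolding sum.distrib sum_product by (simp add: sum_distrib_left)
  also have "\<dots> = log_var + 2 * (0 * 0) + 1 * (n * log_var)"
    by (simp only: Suc.IH[THEN conjunct1] Suc.IH[THEN conjunct2] mean_a sum1 sum_prod_dist mult_1_right
        log_var_def[symmetric])
  also have "\<dots> = Suc n * log_var"
    by (simp add: algebra_simps)
  finally show ?case using mean by blast
qed

text \<open>Chebyshev's inequality, weighted: on \<open>A\<close> the squared deviation is at least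
  \<open>t\<^sup>2\<close> wherever the weight is nonzero, and points of weight zero add nothing to
  either sum.\<close>

lemma log_dev_chebyshev:
  assumes t: "t > 0" and A: "A \<subseteq> {..<d ^ n}"
    and dev: "\<And>x. x \<in> A \<Longrightarrow> prod_dist d p n x \<noteq> 0 \<Longrightarrow> t \<le> \<bar>log_dev n x\<bar>"
  shows "(\<Sum>x\<in>A. prod_dist d p n x) \<le> n * log_var / t\<^sup>2"
proof -
  have "(\<Sum>x\<in>A. prod_dist d p n x) * t\<^sup>2 = (\<Sum>x\<in>A. prod_dist d p n x * t\<^sup>2)"
    by (rule sum_distrib_right)
  also have "\<dots> \<le> (\<Sum>x\<in>A. prod_dist d p n x * (log_dev n x)\<^sup>2)"
  proof (rule sum_mono)
    fix x assume x: "x \<in> A"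
    show "prod_dist d p n x * t\<^sup>2 \<le> prod_dist d p n x * (log_dev n x)\<^sup>2"
    proof (cases "prod_dist d p n x = 0")
      case False
      then have "t\<^sup>2 \<le> (log_dev n x)\<^sup>2" using dev[OF x] t by (simp add: abs_le_square_iff[symmetric])
      then show ?thesis using prod_dist_nonneg[of x n] x A by (intro mult_left_mono) auto
    qed simp
  qed
  also have "\<dots> \<le> (\<Sum>x<d ^ n. prod_dist d p n x * (log_dev n x)\<^sup>2)"
    using A prod_dist_nonneg by (intro sum_mono2) auto
  also have "\<dots> = n * log_var" using log_dev_mean_var by blast
  finally show ?thesis using t by (simp add: pos_le_divide_eq)
qed

text \<open>The mass lost by capping eigenvalues from above, as is done to the source in the
  converse and to the target in the construction. The tail of small eigenvalues has the opposite
  uses.\<close>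

lemma prod_dist_large_tail:
  assumes t: "t > 0"
  shows "(\<Sum>x\<in>{x. x < d ^ n \<and> prod_dist d p n x > 2 powr (t - n * shannon d p)}. prod_dist d p n x)
    \<le> n * log_var / t\<^sup>2"
proof (rule log_dev_chebyshev[OF t])
  fix x assume "x \<in> {x. x < d ^ n \<and> prod_dist d p n x > 2 powr (t - n * shannon d p)}"
  then have "2 powr (t - n * shannon d p) < prod_dist d p n x" by simp
  then have "t - n * shannon d p < log 2 (prod_dist d p n x)"
    using less_log_iff[of 2 "prod_dist d p n x"] by (smt (verit) powr_gt_zero)
  then show "t \<le> \<bar>log_dev n x\<bar>" unfolding log_dev_def by linarith
qed auto

lemma prod_dist_small_tail:
  assumes t: "t > 0"
  shows "(\<Sum>x\<in>{x. x < d ^ n \<and> prod_dist d p n x < 2 powr (- t - n * shannon d p)}. prod_dist d p n x)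
    \<le> n * log_var / t\<^sup>2"
proof (rule log_dev_chebyshev[OF t])
  fix x assume x: "x \<in> {x. x < d ^ n \<and> prod_dist d p n x < 2 powr (- t - n * shannon d p)}"
    and "prod_dist d p n x \<noteq> 0"
  \<comment> \<open>Zero probabilities lie in this set too, but their logarithm is the junk value 0;
    they are excluded before taking logarithms.\<close>
  then have "0 < prod_dist d p n x" "prod_dist d p n x < 2 powr (- t - n * shannon d p)"
    using prod_dist_nonneg[of x n] by auto
  then have "log 2 (prod_dist d p n x) < - t - n * shannon d p"
    using log_less_iff[of 2 "prod_dist d p n x"] by simp
  then show "t \<le> \<bar>log_dev n x\<bar>" unfolding log_dev_def by linarith
qed auto

text \<open>Every member has mass at least \<open>2 powr (- s)\<close>, and the total mass is
  1.\<close>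

lemma card_prod_dist_ge:
  assumes A: "A \<subseteq> {..<d ^ n}" and ge: "\<And>x. x \<in> A \<Longrightarrow> 2 powr (- s) \<le> prod_dist d p n x"
  shows "card A \<le> 2 powr s"
proof -
  have "card A * 2 powr (- s) = (\<Sum>x\<in>A. 2 powr (- s))" by simp
  also have "\<dots> \<le> (\<Sum>x\<in>A. prod_dist d p n x)" by (intro sum_mono ge)
  also have "\<dots> \<le> (\<Sum>x<d ^ n. prod_dist d p n x)"
    using A prod_dist_nonneg by (intro sum_mono2) auto
  also have "\<dots> = 1" by (rule sum_prod_dist)
  finally have "card A * 2 powr (- s) * 2 powr s \<le> 2 powr s" by simp
  then show ?thesis by (simp add: mult.assoc flip: powr_add)
qed

end

subsection \<open>Duality for noisy operations and the converse\<close>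

lemma trace_mult:
  assumes "A \<in> carrier_mat n m" "B \<in> carrier_mat m n"
  shows "mat_trace (A * B) = (\<Sum>i<n. \<Sum>j<m. A $$ (i, j) * B $$ (j, i))"
proof -
  have "mat_trace (A * B) = (\<Sum>i<n. (A * B) $$ (i, i))"
    using assms by (simp add: mat_trace_def)
  also have "\<dots> = (\<Sum>i<n. \<Sum>j<m. A $$ (i, j) * B $$ (j, i))"
    by (intro sum.cong refl index_mult_sum[OF assms]) auto
  finally show ?thesis .
qed

lemma trace_comm:
  assumes "A \<in> carrier_mat n m" "B \<in> carrier_mat m n"
  shows "mat_trace (A * B) = mat_trace (B * A)"
  unfolding trace_mult[OF assms] trace_mult[OF assms(2,1)]
  by (subst sum.swap) (simp add: mult.commute)

lemma quad_form_one: "quad_form d (1\<^sub>m d) v = (\<Sum>i<d. cnj (v i) * v i)"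
proof -
  have "(\<Sum>j<d. (1\<^sub>m d :: complex mat) $$ (i, j) * v j) = v i" if "i < d" for i
  proof -
    have "(\<Sum>j<d. (1\<^sub>m d :: complex mat) $$ (i, j) * v j) = (\<Sum>j<d. if j = i then v j else 0)"
      using that by (intro sum.cong) auto
    then show ?thesis using that by simp
  qed
  then show ?thesis unfolding quad_form_def by simp
qed

lemma quad_form_conj:
  assumes W: "W \<in> carrier_mat d d" and Q: "Q \<in> carrier_mat d d"
  shows "quad_form d (mat_adjoint W * Q * W) v = quad_form d Q (\<lambda>k. \<Sum>j<d. W $$ (k, j) * v j)"
proof -
  let ?w = "\<lambda>k. \<Sum>j<d. W $$ (k, j) * v j"
  have mult_apply: "(\<Sum>j<d. (A * B) $$ (i, j) * x j) = (\<Sum>k<d. A $$ (i, k) * (\<Sum>j<d. B $$ (k, j) * x j))"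
    if "A \<in> carrier_mat d d" "B \<in> carrier_mat d d" "i < d" for A B :: "complex mat" and i x
  proof -
    have "(\<Sum>j<d. (A * B) $$ (i, j) * x j) = (\<Sum>j<d. \<Sum>k<d. A $$ (i, k) * (B $$ (k, j) * x j))"
      by (intro sum.cong refl) (simp add: index_mult_sum[OF that(1,2,3)] sum_distrib_right mult.assoc
          del: index_mult_mat(1))
    then show ?thesis by (subst (asm) sum.swap) (simp add: sum_distrib_left)
  qed
  have "mat_adjoint W * Q * W = mat_adjoint W * (Q * W)"
    using W Q by (intro assoc_mult_mat[of _ d d _ d _ d]) auto
  then have "quad_form d (mat_adjoint W * Q * W) v
    = (\<Sum>i<d. cnj (v i) * (\<Sum>k<d. mat_adjoint W $$ (i, k) * (\<Sum>l<d. Q $$ (k, l) * ?w l)))"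
    unfolding quad_form_def
    using W Q by (auto simp: mult_apply simp del: index_mult_mat(1) intro!: sum.cong)
  also have "\<dots> = (\<Sum>i<d. \<Sum>k<d. cnj (v i) * (cnj (W $$ (k, i)) * (\<Sum>l<d. Q $$ (k, l) * ?w l)))"
    using carrier_matD[OF W] by (simp add: sum_distrib_left)
  also have "\<dots> = (\<Sum>k<d. cnj (?w k) * (\<Sum>l<d. Q $$ (k, l) * ?w l))"
    by (subst sum.swap) (simp add: sum_distrib_right mult_ac)
  finally show ?thesis by (simp add: quad_form_def)
qed

text \<open>The operator inequalities \<open>0 \<le> Q \<le> 1\<close>, that is, a measurement test,
  in terms of quadratic forms. The order on complex numbers also makes the form real.\<close>

definition effect :: "nat \<Rightarrow> complex mat \<Rightarrow> bool" where
  "effect d Q \<longleftrightarrow> Q \<in> carrier_mat d d \<and>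
    (\<forall>v. 0 \<le> quad_form d Q v \<and> quad_form d Q v \<le> quad_form d (1\<^sub>m d) v)"

text \<open>The trace condition on the dual test expresses that \<open>\<Lambda>\<close> maps the maximally mixed state to
  the maximally mixed state.\<close>

definition has_dual :: "nat \<Rightarrow> nat \<Rightarrow> (complex mat \<Rightarrow> complex mat) \<Rightarrow> bool" where
  "has_dual d D \<Lambda> \<longleftrightarrow>
    (\<forall>X. hermitian d X \<longrightarrow> hermitian D (\<Lambda> X)) \<and>
    (\<forall>Q'. effect D Q' \<longrightarrow> (\<exists>Q. effect d Q \<and> mat_trace Q / of_nat d = mat_trace Q' / of_nat D \<and>
      (\<forall>X. hermitian d X \<longrightarrow> mat_trace (Q' * \<Lambda> X) = mat_trace (Q * X))))"

text \<open>Tests are pulled back from the last output inwards, and the trace ratios chain.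
  Preservation of hermiticity lets the dual of \<open>\<Phi>\<close> be applied at
  \<open>\<Lambda> X\<close>.\<close>

lemma has_dual_comp:
  assumes "has_dual d d' \<Lambda>" "has_dual d' d'' \<Phi>"
  shows "has_dual d d'' (\<Phi> \<circ> \<Lambda>)"
  unfolding has_dual_def
proof (intro conjI allI impI)
  show "hermitian d'' ((\<Phi> \<circ> \<Lambda>) X)" if "hermitian d X" for X
    using assms that unfolding has_dual_def comp_def by blast
  fix Q'' assume "effect d'' Q''"
  then obtain Q' where Q': "effect d' Q'" "mat_trace Q' / of_nat d' = mat_trace Q'' / of_nat d''"
    "\<forall>X. hermitian d' X \<longrightarrow> mat_trace (Q'' * \<Phi> X) = mat_trace (Q' * X)"
    using assms(2) unfolding has_dual_def by blast
  then obtain Q where Q: "effect d Q" "mat_trace Q / of_nat d = mat_trace Q' / of_nat d'"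
    "\<forall>X. hermitian d X \<longrightarrow> mat_trace (Q' * \<Lambda> X) = mat_trace (Q * X)"
    using assms(1) unfolding has_dual_def by blast
  show "\<exists>Q. effect d Q \<and> mat_trace Q / of_nat d = mat_trace Q'' / of_nat d'' \<and>
    (\<forall>X. hermitian d X \<longrightarrow> mat_trace (Q'' * (\<Phi> \<circ> \<Lambda>) X) = mat_trace (Q * X))"
    using Q Q' assms(1) unfolding has_dual_def comp_def by metis
qed

text \<open>The dual test is \<open>mat_adjoint W * Q' * W\<close>: conjugation fixes the identity,
  so both bounds survive, and cyclicity of the trace gives the two trace identities.\<close>

lemma has_dual_unitary:
  assumes W: "unitary_mat d W"
  shows "has_dual d d (\<lambda>X. W * X * mat_adjoint W)"
  unfolding has_dual_def
proof (intro conjI allI impI)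
  have [simp]: "W \<in> carrier_mat d d" using W by simp
  note assoc = assoc_mult_mat[of _ d d _ d _ d]
  show "hermitian d (W * X * mat_adjoint W)" if "hermitian d X" for X
    using hermitian_conj[OF that] by simp
  fix Q' assume e: "effect d Q'"
  then have [simp]: "Q' \<in> carrier_mat d d" by (simp add: effect_def)
  let ?Q = "mat_adjoint W * Q' * W"
  have one: "mat_adjoint W * 1\<^sub>m d * W = 1\<^sub>m d"
    using W right_mult_one_mat[of "mat_adjoint W" d d] by (simp add: unitary_mat_def)
  have "effect d ?Q"
    unfolding effect_def
  proof (intro conjI allI)
    fix v
    show "0 \<le> quad_form d ?Q v" using e by (simp add: quad_form_conj effect_def)
    have "quad_form d (1\<^sub>m d) v = quad_form d (mat_adjoint W * 1\<^sub>m d * W) v" by (simp only: one)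
    then show "quad_form d ?Q v \<le> quad_form d (1\<^sub>m d) v"
      using e by (simp add: quad_form_conj effect_def)
  qed simp
  moreover have "mat_trace ?Q = mat_trace Q'"
  proof -
    have "mat_trace ?Q = mat_trace (W * (mat_adjoint W * Q'))" by (rule trace_comm[of _ d d]) auto
    also have "W * (mat_adjoint W * Q') = Q'"
      using unitary_mat_right[OF W] left_mult_one_mat[of Q' d d] by (simp flip: assoc)
    finally show ?thesis .
  qed
  moreover have "mat_trace (Q' * (W * X * mat_adjoint W)) = mat_trace (?Q * X)" if "hermitian d X" for X
  proof -
    have [simp]: "X \<in> carrier_mat d d" using that by (simp add: hermitian_def)
    have "mat_trace (Q' * (W * X * mat_adjoint W)) = mat_trace (Q' * W * X * mat_adjoint W)"
      by (simp add: assoc)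
    also have "\<dots> = mat_trace (mat_adjoint W * (Q' * W * X))" by (rule trace_comm[of _ d d]) auto
    finally show ?thesis by (simp add: assoc)
  qed
  ultimately show "\<exists>Q. effect d Q \<and> mat_trace Q / of_nat d = mat_trace Q' / of_nat d \<and>
      (\<forall>X. hermitian d X \<longrightarrow> mat_trace (Q' * (W * X * mat_adjoint W)) = mat_trace (Q * X))"
    by auto
qed

lemma index_max_mixed: "i < K \<Longrightarrow> j < K \<Longrightarrow> max_mixed K $$ (i, j) = (if i = j then 1 / of_nat K else 0)"
  by (simp add: max_mixed_def)

lemma max_mixed_carrier [simp]: "max_mixed K \<in> carrier_mat K K"
  by (simp add: max_mixed_def)

lemma sum_delta_pair:
  fixes f :: "nat \<Rightarrow> 'a::comm_semiring_1"
  shows "k < b \<Longrightarrow> (\<Sum>l<b. f l * (if l = k then c else 0)) = f k * c"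
    "k < b \<Longrightarrow> (\<Sum>l<b. f l * (if k = l then c else 0)) = f k * c"
  by (simp_all add: if_distrib[of "(*) _"] cong: if_cong)

text \<open>The dual test is the partial trace of \<open>Q'\<close> over the ancilla, divided by
  \<open>K\<close>. Its form is an average of forms of \<open>Q'\<close>, so the bounds persist; its
  trace drops by the factor \<open>K\<close>, as does the dimension.\<close>

lemma has_dual_ancilla:
  assumes K: "K > 0"
  shows "has_dual d (d * K) (\<lambda>X. tensor_mat X (max_mixed K))"
  unfolding has_dual_def
proof (intro conjI allI impI)
  show "hermitian (d * K) (tensor_mat X (max_mixed K))" if X: "hermitian d X" for X
    unfolding hermitian_def
  proof (intro conjI allI impI)
    have c: "X \<in> carrier_mat d d" using X by (simp add: hermitian_def)
    then show "tensor_mat X (max_mixed K) \<in> carrier_mat (d * K) (d * K)" by simp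
    fix x y assume xy: "x < d * K" "y < d * K"
    note xy' = div_mod_less_mult[OF xy(1)] div_mod_less_mult[OF xy(2)]
    have "X $$ (x div K, y div K) = cnj (X $$ (y div K, x div K))"
      using X xy' unfolding hermitian_def by blast
    then show "tensor_mat X (max_mixed K) $$ (x, y) = cnj (tensor_mat X (max_mixed K) $$ (y, x))"
      using xy xy' c by (simp add: index_tensor_mat[OF c max_mixed_carrier] index_max_mixed)
  qed
  fix Q' assume e: "effect (d * K) Q'"
  then have Q': "Q' \<in> carrier_mat (d * K) (d * K)" by (simp add: effect_def)
  define Q where "Q = mat d d (\<lambda>(i, j). (\<Sum>k<K. Q' $$ (i * K + k, j * K + k)) / of_nat K)"
  \<comment> \<open>The tensor product of \<open>v\<close> with basis vector \<open>k\<close> of the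
    ancilla.\<close>
  let ?slice = "\<lambda>v k x. if x mod K = k then v (x div K) else (0::complex)"
  have slice: "quad_form (d * K) A (?slice v k) = (\<Sum>i<d. cnj (v i) * (\<Sum>j<d. A $$ (i * K + k, j * K + k) * v j))"
    if "k < K" for A v k
  proof -
    have inner: "(\<Sum>j<d * K. A $$ (x, j) * ?slice v k j) = (\<Sum>j<d. A $$ (x, j * K + k) * v j)" for x
      unfolding sum_prod_index
    proof (intro sum.cong refl)
      fix j
      have "(\<Sum>l<K. A $$ (x, j * K + l) * ?slice v k (j * K + l))
        = (\<Sum>l<K. A $$ (x, j * K + l) * (if l = k then v j else 0))"
        by (intro sum.cong refl) simp
      then show "(\<Sum>l<K. A $$ (x, j * K + l) * ?slice v k (j * K + l)) = A $$ (x, j * K + k) * v j"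
        using that by (simp only: sum_delta_pair)
    qed
    show ?thesis
      unfolding quad_form_def inner
      unfolding sum_prod_index
    proof (intro sum.cong refl)
      fix i
      let ?R = "\<lambda>l. \<Sum>j<d. A $$ (i * K + l, j * K + k) * v j"
      have "(\<Sum>l<K. cnj (?slice v k (i * K + l)) * ?R l) = (\<Sum>l<K. ?R l * (if l = k then cnj (v i) else 0))"
        by (intro sum.cong refl) simp
      then have "(\<Sum>l<K. cnj (?slice v k (i * K + l)) * ?R l) = ?R k * cnj (v i)"
        using that by (simp only: sum_delta_pair)
      then show "(\<Sum>l<K. cnj (?slice v k (i * K + l)) * ?R l) = cnj (v i) * ?R k"
        by (rule trans) (rule mult.commute)
    qed
  qed
  have qQ: "quad_form d Q v = (\<Sum>k<K. quad_form (d * K) Q' (?slice v k)) / of_nat K" for v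
  proof -
    have "quad_form d Q v
      = (\<Sum>i<d. \<Sum>j<d. \<Sum>k<K. cnj (v i) * (Q' $$ (i * K + k, j * K + k) * v j) / of_nat K)"
      unfolding quad_form_def
      by (auto simp: Q_def sum_distrib_left sum_distrib_right sum_divide_distrib intro!: sum.cong)
    also have "\<dots> = (\<Sum>i<d. \<Sum>k<K. \<Sum>j<d. cnj (v i) * (Q' $$ (i * K + k, j * K + k) * v j) / of_nat K)"
      by (intro sum.cong refl sum.swap)
    also have "\<dots> = (\<Sum>k<K. \<Sum>i<d. \<Sum>j<d. cnj (v i) * (Q' $$ (i * K + k, j * K + k) * v j) / of_nat K)"
      by (rule sum.swap)
    also have "\<dots> = (\<Sum>k<K. quad_form (d * K) Q' (?slice v k)) / of_nat K"
      unfolding sum_divide_distrib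
      by (intro sum.cong refl) (simp add: slice sum_distrib_left sum_divide_distrib)
    finally show ?thesis .
  qed
  \<comment> \<open>Slices have the norm of \<open>v\<close>, so every term of the average obeys the
    same upper bound.\<close>
  have slice_one: "quad_form (d * K) (1\<^sub>m (d * K)) (?slice v k) = quad_form d (1\<^sub>m d) v" if "k < K" for v k
  proof -
    have "(\<Sum>j<d. (1\<^sub>m (d * K) :: complex mat) $$ (i * K + k, j * K + k) * v j)
      = (\<Sum>j<d. (1\<^sub>m d :: complex mat) $$ (i, j) * v j)" if "i < d" for i
      using that \<open>k < K\<close> by (intro sum.cong refl) (simp add: pair_index_less)
    then show ?thesis unfolding slice[OF that] by (simp add: quad_form_def)
  qed
  have "effect d Q"
    unfolding effect_def
  proof (intro conjI allI)
    show "Q \<in> carrier_mat d d" by (simp add: Q_def)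
    fix v
    have "0 \<le> Re (quad_form (d * K) Q' w) \<and> Im (quad_form (d * K) Q' w) = 0
      \<and> Re (quad_form (d * K) Q' w) \<le> Re (quad_form (d * K) (1\<^sub>m (d * K)) w)
      \<and> Im (quad_form (d * K) (1\<^sub>m (d * K)) w) = 0" for w
      using e[unfolded effect_def, THEN conjunct2, rule_format, of w]
      unfolding less_eq_complex_def by auto
    then have b: "0 \<le> Re (quad_form (d * K) Q' (?slice v k)) \<and> Im (quad_form (d * K) Q' (?slice v k)) = 0
      \<and> Re (quad_form (d * K) Q' (?slice v k)) \<le> Re (quad_form d (1\<^sub>m d) v)
      \<and> Im (quad_form d (1\<^sub>m d) v) = 0" if "k < K" for k
      using slice_one[OF that] by metis
    have "(\<Sum>k<K. Re (quad_form (d * K) Q' (?slice v k))) \<le> (\<Sum>k<K. Re (quad_form d (1\<^sub>m d) v))"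
      using b by (intro sum_mono) auto
    moreover have "0 \<le> (\<Sum>k<K. Re (quad_form (d * K) Q' (?slice v k)))"
      using b by (intro sum_nonneg) auto
    moreover have "Im (quad_form d (1\<^sub>m d) v) = 0" using b[OF K] by blast
    moreover have "(\<Sum>k<K. Im (quad_form (d * K) Q' (?slice v k))) = 0"
      using b by (intro sum.neutral) auto
    moreover have "Re (z / of_nat K) = Re z / K" "Im (z / of_nat K) = Im z / K" for z
      by (simp_all add: Re_divide_of_nat Im_divide_of_nat)
    ultimately show "0 \<le> quad_form d Q v" "quad_form d Q v \<le> quad_form d (1\<^sub>m d) v"
      using K unfolding qQ by (simp_all add: less_eq_complex_def field_simps)
  qed
  moreover have "mat_trace Q / of_nat d = mat_trace Q' / of_nat (d * K)"
    using Q' by (simp add: mat_trace_def Q_def sum_prod_index flip: sum_divide_distrib)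
  moreover have "mat_trace (Q' * tensor_mat X (max_mixed K)) = mat_trace (Q * X)" if "hermitian d X" for X
  proof -
    have X: "X \<in> carrier_mat d d" using that by (simp add: hermitian_def)
    have inner: "(\<Sum>y<d * K. Q' $$ (i * K + k, y) * tensor_mat X (max_mixed K) $$ (y, i * K + k))
      = (\<Sum>j<d. Q' $$ (i * K + k, j * K + k) * X $$ (j, i) / of_nat K)"
      if ik: "i < d" "k < K" for i k
      unfolding sum_prod_index
    proof (intro sum.cong refl)
      fix j assume j: "j \<in> {..<d}"
      have "(\<Sum>l<K. Q' $$ (i * K + k, j * K + l) * tensor_mat X (max_mixed K) $$ (j * K + l, i * K + k))
        = (\<Sum>l<K. (Q' $$ (i * K + k, j * K + l) * X $$ (j, i)) * (if l = k then 1 / of_nat K else 0))"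
        using j ik by (intro sum.cong refl)
          (simp add: index_tensor_mat[OF X max_mixed_carrier] index_max_mixed pair_index_less)
      then show "(\<Sum>l<K. Q' $$ (i * K + k, j * K + l) * tensor_mat X (max_mixed K) $$ (j * K + l, i * K + k))
        = Q' $$ (i * K + k, j * K + k) * X $$ (j, i) / of_nat K"
        using ik by (simp only: sum_delta_pair) simp
    qed
    have "mat_trace (Q' * tensor_mat X (max_mixed K))
      = (\<Sum>x<d * K. \<Sum>y<d * K. Q' $$ (x, y) * tensor_mat X (max_mixed K) $$ (y, x))"
      using Q' X by (intro trace_mult) auto
    also have "\<dots> = (\<Sum>i<d. \<Sum>k<K. \<Sum>j<d. Q' $$ (i * K + k, j * K + k) * X $$ (j, i) / of_nat K)"
      by (subst sum_prod_index) (auto simp: inner intro!: sum.cong)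
    also have "\<dots> = (\<Sum>i<d. \<Sum>j<d. \<Sum>k<K. Q' $$ (i * K + k, j * K + k) * X $$ (j, i) / of_nat K)"
      by (intro sum.cong refl sum.swap)
    also have "\<dots> = mat_trace (Q * X)"
      using X by (subst trace_mult[of Q d d X])
        (auto simp: Q_def sum_distrib_right sum_divide_distrib intro!: sum.cong)
    finally show ?thesis .
  qed
  ultimately show "\<exists>Q. effect d Q \<and> mat_trace Q / of_nat d = mat_trace Q' / of_nat (d * K) \<and>
      (\<forall>X. hermitian d X \<longrightarrow> mat_trace (Q' * tensor_mat X (max_mixed K)) = mat_trace (Q * X))"
    by blast
qed

text \<open>The dual test is \<open>Q'\<close> tensored with the identity. Its form is a sum of
  forms of \<open>Q'\<close> over the values of the discarded index, and its trace grows by the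
  factor \<open>b\<close>, as does the dimension.\<close>

lemma has_dual_partial_trace:
  assumes b: "b > 0"
  shows "has_dual (a * b) a (partial_trace a b)"
  unfolding has_dual_def
proof (intro conjI allI impI)
  show "hermitian a (partial_trace a b X)" if X: "hermitian (a * b) X" for X
    unfolding hermitian_def
  proof (intro conjI allI impI)
    show "partial_trace a b X \<in> carrier_mat a a" by (simp add: partial_trace_def)
    fix i j assume ij: "i < a" "j < a"
    have "X $$ (i * b + k, j * b + k) = cnj (X $$ (j * b + k, i * b + k))" if "k < b" for k
      using X pair_index_less[OF ij(1) that] pair_index_less[OF ij(2) that] unfolding hermitian_def by blast
    then have "(\<Sum>k<b. X $$ (i * b + k, j * b + k)) = (\<Sum>k<b. cnj (X $$ (j * b + k, i * b + k)))"
      by (intro sum.cong refl) auto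
    then show "partial_trace a b X $$ (i, j) = cnj (partial_trace a b X $$ (j, i))"
      using ij by (simp add: partial_trace_def)
  qed
  fix Q' assume e: "effect a Q'"
  then have Q': "Q' \<in> carrier_mat a a" by (simp add: effect_def)
  let ?Q = "tensor_mat Q' (1\<^sub>m b)"
  have qf: "quad_form (a * b) (tensor_mat A (1\<^sub>m b)) v = (\<Sum>k<b. quad_form a A (\<lambda>i. v (i * b + k)))"
    if A: "A \<in> carrier_mat a a" for A v
  proof -
    have inner: "(\<Sum>y<a * b. tensor_mat A (1\<^sub>m b) $$ (i * b + k, y) * v y) = (\<Sum>j<a. A $$ (i, j) * v (j * b + k))"
      if ik: "i < a" "k < b" for i k
      unfolding sum_prod_index
    proof (intro sum.cong refl)
      fix j assume j: "j \<in> {..<a}"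
      have "(\<Sum>l<b. tensor_mat A (1\<^sub>m b) $$ (i * b + k, j * b + l) * v (j * b + l))
        = (\<Sum>l<b. (A $$ (i, j) * v (j * b + l)) * (if l = k then 1 else 0))"
        using j ik by (intro sum.cong refl) (simp add: index_tensor_mat[OF A one_carrier_mat] pair_index_less)
      then show "(\<Sum>l<b. tensor_mat A (1\<^sub>m b) $$ (i * b + k, j * b + l) * v (j * b + l)) = A $$ (i, j) * v (j * b + k)"
        using ik by (simp only: sum_delta_pair) simp
    qed
    have "quad_form (a * b) (tensor_mat A (1\<^sub>m b)) v
      = (\<Sum>i<a. \<Sum>k<b. cnj (v (i * b + k)) * (\<Sum>j<a. A $$ (i, j) * v (j * b + k)))"
      unfolding quad_form_def
      by (subst sum_prod_index) (auto simp: inner intro!: sum.cong)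
    also have "\<dots> = (\<Sum>k<b. quad_form a A (\<lambda>i. v (i * b + k)))"
      unfolding quad_form_def by (rule sum.swap)
    finally show ?thesis .
  qed
  \<comment> \<open>With the identity itself in tensor form, the upper bound becomes a comparison
    slice by slice.\<close>
  have one: "1\<^sub>m (a * b) = tensor_mat (1\<^sub>m a) (1\<^sub>m b :: complex mat)"
  proof (rule eq_matI)
    fix x y assume "x < dim_row (tensor_mat (1\<^sub>m a) (1\<^sub>m b))" "y < dim_col (tensor_mat (1\<^sub>m a) (1\<^sub>m b))"
    then have xy: "x < a * b" "y < a * b" by (auto simp: tensor_mat_def)
    show "1\<^sub>m (a * b) $$ (x, y) = tensor_mat (1\<^sub>m a) (1\<^sub>m b) $$ (x, y)"
      using xy div_mod_less_mult[OF xy(1)] div_mod_less_mult[OF xy(2)]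
      by (auto simp: index_tensor_mat[OF one_carrier_mat one_carrier_mat]) (metis div_mod_decomp)
  qed (auto simp: tensor_mat_def)
  have "effect (a * b) ?Q"
    unfolding effect_def
  proof (intro conjI allI)
    show "?Q \<in> carrier_mat (a * b) (a * b)" using Q' by simp
    fix v
    show "0 \<le> quad_form (a * b) ?Q v"
      unfolding qf[OF Q'] using e by (intro sum_nonneg) (auto simp: effect_def)
    show "quad_form (a * b) ?Q v \<le> quad_form (a * b) (1\<^sub>m (a * b)) v"
      unfolding one qf[OF Q'] qf[OF one_carrier_mat] using e by (intro sum_mono) (auto simp: effect_def)
  qed
  moreover have "mat_trace ?Q / of_nat (a * b) = mat_trace Q' / of_nat a"
  proof -
    have "mat_trace ?Q = (\<Sum>i<a. \<Sum>k<b. ?Q $$ (i * b + k, i * b + k))"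
      using carrier_matD(1)[OF tensor_mat_carrier[OF Q' one_carrier_mat[of b]]]
      by (simp only: mat_trace_def sum_prod_index)
    also have "\<dots> = (\<Sum>i<a. \<Sum>k<b. Q' $$ (i, i))"
      by (intro sum.cong refl) (simp add: index_tensor_mat[OF Q' one_carrier_mat] pair_index_less)
    also have "\<dots> = of_nat b * mat_trace Q'"
      using Q' by (simp add: mat_trace_def sum_distrib_left)
    finally show ?thesis using b by simp
  qed
  moreover have "mat_trace (Q' * partial_trace a b X) = mat_trace (?Q * X)" if "hermitian (a * b) X" for X
  proof -
    have X: "X \<in> carrier_mat (a * b) (a * b)" using that by (simp add: hermitian_def)
    have inner: "(\<Sum>y<a * b. ?Q $$ (i * b + k, y) * X $$ (y, i * b + k))
      = (\<Sum>j<a. Q' $$ (i, j) * X $$ (j * b + k, i * b + k))" if ik: "i < a" "k < b" for i k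
      unfolding sum_prod_index
    proof (intro sum.cong refl)
      fix j assume j: "j \<in> {..<a}"
      have "(\<Sum>l<b. ?Q $$ (i * b + k, j * b + l) * X $$ (j * b + l, i * b + k))
        = (\<Sum>l<b. (Q' $$ (i, j) * X $$ (j * b + l, i * b + k)) * (if l = k then 1 else 0))"
        using j ik by (intro sum.cong refl) (simp add: index_tensor_mat[OF Q' one_carrier_mat] pair_index_less)
      then show "(\<Sum>l<b. ?Q $$ (i * b + k, j * b + l) * X $$ (j * b + l, i * b + k))
        = Q' $$ (i, j) * X $$ (j * b + k, i * b + k)"
        using ik by (simp only: sum_delta_pair) simp
    qed
    have "mat_trace (?Q * X) = (\<Sum>x<a * b. \<Sum>y<a * b. ?Q $$ (x, y) * X $$ (y, x))"
      using Q' X by (intro trace_mult) auto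
    also have "\<dots> = (\<Sum>i<a. \<Sum>k<b. \<Sum>j<a. Q' $$ (i, j) * X $$ (j * b + k, i * b + k))"
      by (subst sum_prod_index) (auto simp: inner intro!: sum.cong)
    also have "\<dots> = (\<Sum>i<a. \<Sum>j<a. \<Sum>k<b. Q' $$ (i, j) * X $$ (j * b + k, i * b + k))"
      by (intro sum.cong refl sum.swap)
    also have "\<dots> = mat_trace (Q' * partial_trace a b X)"
      using Q' by (subst trace_mult[of Q' a a])
        (auto simp: partial_trace_def sum_distrib_left intro!: sum.cong)
    finally show ?thesis ..
  qed
  ultimately show "\<exists>Q. effect (a * b) Q \<and> mat_trace Q / of_nat (a * b) = mat_trace Q' / of_nat a \<and>
      (\<forall>X. hermitian (a * b) X \<longrightarrow> mat_trace (Q' * partial_trace a b X) = mat_trace (Q * X))"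
    by blast
qed

text \<open>The trace ratio survives a discard only if the discarded factor has positive dimension,
  which follows when the input dimension is positive. Positivity is therefore part of the induction:
  in a composition the first map hands it to the second.\<close>

lemma noisy_op_has_dual:
  assumes "noisy_op d D \<Lambda>" "d > 0"
  shows "D > 0 \<and> has_dual d D \<Lambda>"
  using assms
proof (induction rule: noisy_op.induct)
  case (step d d' \<Lambda>)
  then show ?case
  proof cases
    case (unitary U)
    then show ?thesis using has_dual_unitary step by simp
  next
    case (ancilla K)
    then show ?thesis using has_dual_ancilla step by simp
  next
    case (discard b W)
    then have "\<Lambda> = partial_trace d' b \<circ> (\<lambda>X. W * X * mat_adjoint W)" by (simp add: comp_def)
    then show ?thesis using has_dual_comp[OF has_dual_unitary has_dual_partial_trace] discard step by simp
  qed
next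
  case (comp d d' \<Lambda> d'' \<Phi>)
  then show ?case using has_dual_comp[of d d' \<Lambda> d'' \<Phi>] by blast
qed

section \<open>Tests applied to diagonalized operators\<close>

lemma trace_mult_udiag:
  assumes Q: "Q \<in> carrier_mat d d" and U: "U \<in> carrier_mat d d"
  shows "mat_trace (Q * udiag d U f) = (\<Sum>i<d. of_real (f i) * quad_form d Q (\<lambda>k. U $$ (k, i)))"
proof -
  have "mat_trace (Q * udiag d U f)
    = (\<Sum>x<d. \<Sum>y<d. \<Sum>i<d. of_real (f i) * (cnj (U $$ (x, i)) * (Q $$ (x, y) * U $$ (y, i))))"
    unfolding trace_mult[OF Q udiag_carrier[OF U]]
    using U by (auto simp: index_udiag sum_distrib_left mult_ac intro!: sum.cong)
  also have "\<dots> = (\<Sum>x<d. \<Sum>i<d. \<Sum>y<d. of_real (f i) * (cnj (U $$ (x, i)) * (Q $$ (x, y) * U $$ (y, i))))"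
    by (intro sum.cong refl sum.swap)
  also have "\<dots> = (\<Sum>i<d. \<Sum>x<d. \<Sum>y<d. of_real (f i) * (cnj (U $$ (x, i)) * (Q $$ (x, y) * U $$ (y, i))))"
    by (rule sum.swap)
  finally show ?thesis by (simp add: quad_form_def sum_distrib_left)
qed

text \<open>Columns of a unitary are unit vectors, so these forms are acceptance
  probabilities.\<close>

lemma effect_quad_form_col:
  assumes e: "effect d Q" and U: "unitary_mat d U" and i: "i < d"
  shows "0 \<le> Re (quad_form d Q (\<lambda>k. U $$ (k, i)))" "Re (quad_form d Q (\<lambda>k. U $$ (k, i))) \<le> 1"
    "Im (quad_form d Q (\<lambda>k. U $$ (k, i))) = 0"
proof -
  have "quad_form d (1\<^sub>m d) (\<lambda>k. U $$ (k, i)) = 1"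
    unfolding quad_form_one using unitary_mat_cols[OF U i i] by simp
  moreover have "0 \<le> quad_form d Q (\<lambda>k. U $$ (k, i)) \<and>
    quad_form d Q (\<lambda>k. U $$ (k, i)) \<le> quad_form d (1\<^sub>m d) (\<lambda>k. U $$ (k, i))"
    using e by (simp add: effect_def)
  ultimately show "0 \<le> Re (quad_form d Q (\<lambda>k. U $$ (k, i)))" "Re (quad_form d Q (\<lambda>k. U $$ (k, i))) \<le> 1"
    "Im (quad_form d Q (\<lambda>k. U $$ (k, i))) = 0"
    by (simp_all add: less_eq_complex_def)
qed

text \<open>In an eigenbasis of \<open>H\<close> the trace is a sum of eigenvalues with weights
  between 0 and 1. This is how closeness in trace norm enters the converse.\<close>

lemma effect_trace_le_trace_norm:
  assumes e: "effect d Q" and H: "hermitian d H"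
  shows "\<bar>Re (mat_trace (Q * H))\<bar> \<le> trace_norm H"
proof -
  obtain U f where U: "unitary_mat d U" and H: "H = udiag d U f"
    using hermitian_diagonalization[OF H] .
  let ?w = "\<lambda>i. Re (quad_form d Q (\<lambda>k. U $$ (k, i)))"
  have "Re (mat_trace (Q * H)) = (\<Sum>i<d. f i * ?w i)"
    unfolding H using e U by (subst trace_mult_udiag) (auto simp: effect_def)
  also have "\<bar>\<dots>\<bar> \<le> (\<Sum>i<d. \<bar>f i * ?w i\<bar>)" by (rule sum_abs)
  also have "\<dots> \<le> (\<Sum>i<d. \<bar>f i\<bar>)"
    using effect_quad_form_col[OF e U]
    by (intro sum_mono) (auto simp: abs_mult intro!: mult_left_le)
  finally show ?thesis unfolding H trace_norm_udiag[OF U] .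
qed

lemma effect_udiag:
  assumes U: "unitary_mat d U" and f: "\<And>i. i < d \<Longrightarrow> 0 \<le> f i \<and> f i \<le> 1"
  shows "effect d (udiag d U f)"
  unfolding effect_def
proof (intro conjI allI)
  have c: "U \<in> carrier_mat d d" using U by simp
  then show "udiag d U f \<in> carrier_mat d d" by simp
  fix v
  let ?s = "\<lambda>l. (cmod (\<Sum>i<d. cnj (U $$ (i, l)) * v i))\<^sup>2"
  have "0 \<le> (\<Sum>l<d. f l * ?s l)" using f by (intro sum_nonneg) auto
  then show "0 \<le> quad_form d (udiag d U f) v"
    unfolding quad_form_udiag[OF c] by (simp add: less_eq_complex_def)
  have "(\<Sum>l<d. f l * ?s l) \<le> (\<Sum>l<d. 1 * ?s l)" using f by (intro sum_mono mult_right_mono) auto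
  then show "quad_form d (udiag d U f) v \<le> quad_form d (1\<^sub>m d) v"
    unfolding udiag_one[OF U, symmetric] quad_form_udiag[OF c] by (simp add: less_eq_complex_def)
qed

lemma mat_trace_minus:
  "A \<in> carrier_mat n n \<Longrightarrow> B \<in> carrier_mat n n \<Longrightarrow> mat_trace (A - B) = mat_trace A - mat_trace B"
  by (auto simp: mat_trace_def sum_subtractf)

lemma hermitian_udiag: "U \<in> carrier_mat d d \<Longrightarrow> hermitian d (udiag d U f)"
  by (simp add: hermitian_adjoint adjoint_udiag)

lemma hermitian_minus:
  assumes "hermitian d A" "hermitian d B"
  shows "hermitian d (A - B)"
proof -
  have c: "A \<in> carrier_mat d d" "B \<in> carrier_mat d d"
    using assms unfolding hermitian_def by blast+
  show ?thesis
    unfolding hermitian_def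
  proof (intro conjI allI impI)
    fix i j assume ij: "i < d" "j < d"
    then have "A $$ (i, j) = cnj (A $$ (j, i))" "B $$ (i, j) = cnj (B $$ (j, i))"
      using assms unfolding hermitian_def by blast+
    moreover have "(A - B) $$ (i, j) = A $$ (i, j) - B $$ (i, j)" "(A - B) $$ (j, i) = A $$ (j, i) - B $$ (j, i)"
      using c ij by auto
    ultimately show "(A - B) $$ (i, j) = cnj ((A - B) $$ (j, i))" by (simp only: complex_cnj_diff)
  qed (use c in auto)
qed

text \<open>The test \<open>Q'\<close> projects onto the eigenvectors of the target in
  \<open>T'\<close>. Its pullback accepts eigenvector \<open>i\<close> of the source with a weight
  in the unit interval, and these weights total \<open>d * card T' / D\<close>. Off \<open>T\<close>
  the weight is replaced by 1, on \<open>T\<close> the eigenvalue is replaced by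
  \<open>c\<close>.\<close>

lemma noisy_op_converse:
  assumes noisy: "noisy_op d D \<Lambda>" and d: "d > 0"
    and U: "unitary_mat d U" and V: "unitary_mat D V"
    and p: "\<And>i. i < d \<Longrightarrow> 0 \<le> p i"
    and T: "T \<subseteq> {..<d}" "\<And>i. i \<in> T \<Longrightarrow> p i \<le> c" and c: "0 \<le> c"
    and T': "T' \<subseteq> {..<D}"
  shows "(\<Sum>j\<in>T'. q j) - trace_norm (\<Lambda> (udiag d U p) - udiag D V q)
    \<le> (\<Sum>i\<in>{..<d} - T. p i) + c * (d * card T' / D)"
proof -
  have Uc: "U \<in> carrier_mat d d" and Vc: "V \<in> carrier_mat D D" using U V by auto
  have D: "D > 0" and dual: "has_dual d D \<Lambda>" using noisy_op_has_dual[OF noisy d] by auto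
  define ind where "ind j = (if j \<in> T' then 1 else 0 :: real)" for j
  define Q' where "Q' = udiag D V ind"
  have eQ': "effect D Q'" unfolding Q'_def by (rule effect_udiag[OF V]) (simp add: ind_def)
  have sum_ind: "(\<Sum>j<D. ind j * f j) = (\<Sum>j\<in>T'. f j)" for f :: "nat \<Rightarrow> real"
  proof -
    have "(\<Sum>j<D. ind j * f j) = (\<Sum>j<D. if j \<in> T' then f j else 0)"
      by (intro sum.cong refl) (simp add: ind_def)
    also have "\<dots> = (\<Sum>j\<in>{..<D} \<inter> T'. f j)" by (simp add: sum.inter_restrict)
    finally show ?thesis using T' by (simp add: Int_absorb1)
  qed
  have trQ': "mat_trace Q' = of_nat (card T')"
    using sum_ind[of "\<lambda>_. 1"] unfolding Q'_def trace_udiag[OF V] by simp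
  let ?A = "udiag d U p" and ?B = "udiag D V q"
  have hA: "hermitian d ?A" using hermitian_udiag[OF Uc] .
  then have h\<Lambda>: "hermitian D (\<Lambda> ?A)" using dual unfolding has_dual_def by blast
  obtain Q where eQ: "effect d Q" and trQ: "mat_trace Q / of_nat d = mat_trace Q' / of_nat D"
    and QA: "mat_trace (Q' * \<Lambda> ?A) = mat_trace (Q * ?A)"
    using dual eQ' hA unfolding has_dual_def by blast
  have Qc: "Q \<in> carrier_mat d d" and Qc': "Q' \<in> carrier_mat D D" using eQ eQ' by (auto simp: effect_def)
  let ?w = "\<lambda>i. Re (quad_form d Q (\<lambda>k. U $$ (k, i)))"
  note w = effect_quad_form_col[OF eQ U]
  \<comment> \<open>The trace of \<open>Q\<close> computed in the eigenbasis of the source; the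
    trace ratio of dual tests enters here.\<close>
  have sum_w: "(\<Sum>i<d. ?w i) = d * card T' / D"
  proof -
    have "mat_trace Q = mat_trace (Q * udiag d U (\<lambda>_. 1))"
      using udiag_one[OF U] right_mult_one_mat[OF Qc] by simp
    then have "Re (mat_trace Q) = (\<Sum>i<d. ?w i)" unfolding trace_mult_udiag[OF Qc Uc] by simp
    moreover have "mat_trace Q = of_real (d * card T' / D)"
      using trQ d D by (simp add: trQ' field_simps)
    ultimately show ?thesis by simp
  qed
  have "Re (mat_trace (Q * ?A)) = (\<Sum>i<d. p i * ?w i)"
    unfolding trace_mult_udiag[OF Qc Uc] by simp
  also have "\<dots> = (\<Sum>i\<in>{..<d} - T. p i * ?w i) + (\<Sum>i\<in>T. p i * ?w i)"
    using T(1) by (intro sum.subset_diff) auto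
  also have "\<dots> \<le> (\<Sum>i\<in>{..<d} - T. p i) + (\<Sum>i\<in>T. c * ?w i)"
    using p w T by (intro add_mono sum_mono mult_left_le mult_right_mono) auto
  also have "(\<Sum>i\<in>T. c * ?w i) \<le> (\<Sum>i<d. c * ?w i)"
    using T(1) c w by (intro sum_mono2) auto
  also have "\<dots> = c * (d * card T' / D)" by (simp only: sum_w flip: sum_distrib_left)
  finally have upper: "Re (mat_trace (Q * ?A)) \<le> (\<Sum>i\<in>{..<d} - T. p i) + c * (d * card T' / D)" by simp
  have "Re (mat_trace (Q' * ?B)) = (\<Sum>j\<in>T'. q j)"
    unfolding Q'_def udiag_mult[OF V] trace_udiag[OF V] by (simp add: sum_ind)
  moreover have "Q' * (\<Lambda> ?A - ?B) = Q' * \<Lambda> ?A - Q' * ?B"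
    using Qc' h\<Lambda> Vc by (intro mult_minus_distrib_mat[of _ D D _ D]) (auto simp: hermitian_def)
  then have "mat_trace (Q' * (\<Lambda> ?A - ?B)) = mat_trace (Q' * \<Lambda> ?A) - mat_trace (Q' * ?B)"
    using Qc' h\<Lambda> Vc by (simp add: mat_trace_minus[of _ D] hermitian_def)
  moreover have "\<bar>Re (mat_trace (Q' * (\<Lambda> ?A - ?B)))\<bar> \<le> trace_norm (\<Lambda> ?A - ?B)"
    by (intro effect_trace_le_trace_norm[OF eQ'] hermitian_minus h\<Lambda> hermitian_udiag Vc)
  ultimately show ?thesis using upper QA by simp
qed

subsection \<open>Achievability\<close>

lemma udiag_one_mat: "udiag d (1\<^sub>m d) f = mat_diag d (\<lambda>i. of_real (f i))"
  unfolding udiag_def using left_mult_one_mat[of "mat_diag d (\<lambda>i. complex_of_real (f i))" d d]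
    right_mult_one_mat[of "mat_diag d (\<lambda>i. complex_of_real (f i))" d d] by simp

lemma index_mat_diag: "i < n \<Longrightarrow> j < n \<Longrightarrow> mat_diag n f $$ (i, j) = (if i = j then f j else 0)"
  by (simp add: mat_diag_def)

text \<open>Index \<open>x\<close> stands for piece \<open>x mod K\<close> of eigenvalue number
  \<open>x div K\<close>.\<close>

lemma tensor_mat_diag_max_mixed:
  "tensor_mat (mat_diag d (\<lambda>i. of_real (f i))) (max_mixed K)
    = mat_diag (d * K) (\<lambda>x. of_real (f (x div K) / K))"
proof (rule eq_matI)
  fix x y assume "x < dim_row (mat_diag (d * K) (\<lambda>x. complex_of_real (f (x div K) / K)))"
    "y < dim_col (mat_diag (d * K) (\<lambda>x. complex_of_real (f (x div K) / K)))"
  then have xy: "x < d * K" "y < d * K" by (auto simp: mat_diag_def)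
  note xy' = div_mod_less_mult[OF xy(1)] div_mod_less_mult[OF xy(2)]
  have eq: "x = y \<longleftrightarrow> x div K = y div K \<and> x mod K = y mod K" by (metis div_mod_decomp)
  show "tensor_mat (mat_diag d (\<lambda>i. complex_of_real (f i))) (max_mixed K) $$ (x, y)
    = mat_diag (d * K) (\<lambda>x. complex_of_real (f (x div K) / K)) $$ (x, y)"
    using xy xy' unfolding index_tensor_mat[OF mat_diag_dim max_mixed_carrier xy]
    by (simp add: index_mat_diag index_max_mixed eq)
qed (auto simp: tensor_mat_def mat_diag_def max_mixed_def)

text \<open>Each block of \<open>b\<close> consecutive positions is merged into one eigenvalue, so
  it remains only to move the pieces into the right blocks.\<close>

lemma partial_trace_mat_diag:
  "partial_trace a b (mat_diag (a * b) (\<lambda>x. of_real (f x))) = mat_diag a (\<lambda>i. of_real (\<Sum>k<b. f (i * b + k)))"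
proof (rule eq_matI)
  fix i j assume "i < dim_row (mat_diag a (\<lambda>i. complex_of_real (\<Sum>k<b. f (i * b + k))))"
    "j < dim_col (mat_diag a (\<lambda>i. complex_of_real (\<Sum>k<b. f (i * b + k))))"
  then have ij: "i < a" "j < a" by (auto simp: mat_diag_def)
  have "(\<Sum>k<b. mat_diag (a * b) (\<lambda>x. complex_of_real (f x)) $$ (i * b + k, j * b + k))
    = (\<Sum>k<b. if i = j then of_real (f (j * b + k)) else 0)"
    using ij by (intro sum.cong refl) (auto simp: index_mat_diag pair_index_less)
  then show "partial_trace a b (mat_diag (a * b) (\<lambda>x. complex_of_real (f x))) $$ (i, j)
    = mat_diag a (\<lambda>i. complex_of_real (\<Sum>k<b. f (i * b + k))) $$ (i, j)"
    using ij by (simp add: partial_trace_def index_mat_diag)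
qed (auto simp: partial_trace_def mat_diag_def)

text \<open>Row \<open>y\<close> selects coordinate \<open>\<pi> y\<close>, so conjugation brings to
  position \<open>y\<close> the diagonal entry found at \<open>\<pi> y\<close>.\<close>

definition perm_mat :: "nat \<Rightarrow> (nat \<Rightarrow> nat) \<Rightarrow> complex mat" where
  "perm_mat n \<pi> = mat n n (\<lambda>(y, x). if x = \<pi> y then 1 else 0)"

lemma unitary_perm_mat:
  assumes "bij_betw \<pi> {..<n} {..<n}"
  shows "unitary_mat n (perm_mat n \<pi>)"
  unfolding unitary_mat_iff
proof (intro conjI allI impI)
  fix i j assume ij: "i < n" "j < n"
  have "(\<Sum>k<n. cnj (perm_mat n \<pi> $$ (k, i)) * perm_mat n \<pi> $$ (k, j))
    = (\<Sum>k<n. (\<lambda>x. if x = i then if i = j then 1 else 0 else 0) (\<pi> k))"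
    using ij by (intro sum.cong refl) (auto simp: perm_mat_def)
  also have "\<dots> = (\<Sum>x<n. if x = i then if i = j then 1 else 0 else 0)"
    by (rule sum.reindex_bij_betw[OF assms])
  finally show "(\<Sum>k<n. cnj (perm_mat n \<pi> $$ (k, i)) * perm_mat n \<pi> $$ (k, j)) = (if i = j then 1 else 0)"
    using ij by simp
qed (simp add: perm_mat_def)

lemma perm_mat_conj_mat_diag:
  assumes "bij_betw \<pi> {..<n} {..<n}"
  shows "perm_mat n \<pi> * mat_diag n (\<lambda>x. of_real (f x)) * mat_adjoint (perm_mat n \<pi>)
    = mat_diag n (\<lambda>y. of_real (f (\<pi> y)))"
proof -
  have c: "perm_mat n \<pi> \<in> carrier_mat n n" by (simp add: perm_mat_def)
  have "udiag n (perm_mat n \<pi>) f = mat_diag n (\<lambda>y. of_real (f (\<pi> y)))"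
  proof (rule eq_matI)
    fix i j assume "i < dim_row (mat_diag n (\<lambda>y. complex_of_real (f (\<pi> y))))"
      "j < dim_col (mat_diag n (\<lambda>y. complex_of_real (f (\<pi> y))))"
    then have ij: "i < n" "j < n" by (auto simp: mat_diag_def)
    have \<pi>i: "\<pi> i < n" using assms ij(1) by (auto simp: bij_betw_def)
    have \<pi>eq: "\<pi> i = \<pi> j \<longleftrightarrow> i = j" using assms ij by (auto simp: bij_betw_def inj_on_def)
    have "udiag n (perm_mat n \<pi>) f $$ (i, j) = (\<Sum>l<n. if l = \<pi> i then if i = j then of_real (f l) else 0 else 0)"
      unfolding index_udiag[OF c ij] using ij \<pi>eq by (intro sum.cong refl) (auto simp: perm_mat_def)
    then show "udiag n (perm_mat n \<pi>) f $$ (i, j) = mat_diag n (\<lambda>y. complex_of_real (f (\<pi> y))) $$ (i, j)"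
      using ij \<pi>i by (simp add: index_mat_diag)
  qed (use c in \<open>auto simp: mat_diag_def\<close>)
  then show ?thesis by (simp add: udiag_def)
qed

section \<open>Combinatorics of distributing the pieces into groups\<close>

lemma disjoint_subsets_with_cards:
  assumes "finite J" "finite A" "(\<Sum>j\<in>J. c j) \<le> card A"
  obtains B where "\<And>j. j \<in> J \<Longrightarrow> B j \<subseteq> A" "\<And>j. j \<in> J \<Longrightarrow> card (B j) = c j"
    "\<And>i j. i \<in> J \<Longrightarrow> j \<in> J \<Longrightarrow> i \<noteq> j \<Longrightarrow> B i \<inter> B j = {}"
proof -
  have "\<exists>B. (\<forall>j\<in>J. B j \<subseteq> A \<and> card (B j) = c j) \<and> (\<forall>i\<in>J. \<forall>j\<in>J. i \<noteq> j \<longrightarrow> B i \<inter> B j = {})"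
    using assms(1,3)
  proof (induction J)
    case (insert j J)
    then obtain B where B: "\<forall>j\<in>J. B j \<subseteq> A \<and> card (B j) = c j"
      "\<forall>i\<in>J. \<forall>j\<in>J. i \<noteq> j \<longrightarrow> B i \<inter> B j = {}" by auto
    have fin: "\<forall>j\<in>J. finite (B j)" using B(1) assms(2) finite_subset by blast
    have "card (\<Union>j\<in>J. B j) = (\<Sum>j\<in>J. c j)"
      using card_UN_disjoint[OF insert.hyps(1) fin B(2)] B(1) by simp
    moreover have "card (A - (\<Union>j\<in>J. B j)) = card A - card (\<Union>j\<in>J. B j)"
      using B(1) insert.hyps(1) fin by (intro card_Diff_subset) auto
    \<comment> \<open>Greedy choice: what the earlier sets leave of \<open>A\<close> has room for
      the next one.\<close>
    ultimately have "c j \<le> card (A - (\<Union>j\<in>J. B j))"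
      using insert.prems insert.hyps by simp
    then obtain S where S: "S \<subseteq> A - (\<Union>j\<in>J. B j)" "card S = c j"
      using obtain_subset_with_card_n by metis
    show ?case
      using B S insert.hyps(2) by (intro exI[of _ "B(j := S)"]) (auto; blast)
  qed auto
  then obtain B where B: "\<forall>j\<in>J. B j \<subseteq> A \<and> card (B j) = c j"
    "\<forall>i\<in>J. \<forall>j\<in>J. i \<noteq> j \<longrightarrow> B i \<inter> B j = {}" by blast
  show ?thesis by (rule that[of B]) (use B in simp_all)
qed

text \<open>Pieces are numbered \<open>i * K + k\<close> with \<open>i < d\<close>, \<open>k < K\<close>. The group \<open>G j\<close> receives \<open>c j\<close> of the
  pieces of every \<open>i \<in> T\<close> and is filled up arbitrarily.\<close>

lemma balanced_grouping:
  fixes p :: "nat \<Rightarrow> real"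
  assumes p: "\<And>i. i < d \<Longrightarrow> 0 \<le> p i"
    and T: "T \<subseteq> {..<d}" and T': "T' \<subseteq> {..<D}"
    and pieces: "(\<Sum>j\<in>T'. c j) \<le> K" and slots: "\<And>j. j \<in> T' \<Longrightarrow> card T * c j \<le> b"
    and total: "d * K = D * b"
  obtains G where "\<And>j. j < D \<Longrightarrow> G j \<subseteq> {..<D * b}" "\<And>j. j < D \<Longrightarrow> card (G j) = b"
    "\<And>i j. i < D \<Longrightarrow> j < D \<Longrightarrow> i \<noteq> j \<Longrightarrow> G i \<inter> G j = {}"
    "\<And>j. j \<in> T' \<Longrightarrow> (\<Sum>i\<in>T. p i) * c j \<le> (\<Sum>x\<in>G j. p (x div K))"
proof -
  have finT: "finite T" "finite T'" using T T' finite_subset by auto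
  \<comment> \<open>\<open>B j\<close> holds the piece labels reserved for group \<open>j\<close>,
    the same for every \<open>i\<close>; by \<open>pieces\<close> they fit disjointly into the
    \<open>K\<close> labels.\<close>
  obtain B where B: "\<And>j. j \<in> T' \<Longrightarrow> B j \<subseteq> {..<K}" "\<And>j. j \<in> T' \<Longrightarrow> card (B j) = c j"
    "\<And>i j. i \<in> T' \<Longrightarrow> j \<in> T' \<Longrightarrow> i \<noteq> j \<Longrightarrow> B i \<inter> B j = {}"
    using disjoint_subsets_with_cards[OF finT(2), of "{..<K}" c] pieces by auto
  define F where "F j = (if j \<in> T' then (\<lambda>(i, k). i * K + k) ` (T \<times> B j) else {})" for j
  have inj: "inj_on (\<lambda>(i, k). i * K + k) (T \<times> B j)" if "j \<in> T'" for j
  proof (rule inj_onI, clarify)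
    fix i k i' k' assume "k \<in> B j" "k' \<in> B j" and eq: "i * K + k = i' * K + k'"
    then have "k < K" "k' < K" using B(1)[OF that] by auto
    then show "i = i' \<and> k = k'" using eq by (metis pair_index_div_mod)
  qed
  have F_mem: "x div K \<in> T \<and> x mod K \<in> B j \<and> j \<in> T'" if "x \<in> F j" for x j
    using that B(1)[of j] by (auto simp: F_def split: if_splits)
  have F_sub: "F j \<subseteq> {..<D * b}" for j
  proof
    fix x assume "x \<in> F j"
    then obtain i k where "j \<in> T'" "i \<in> T" "k \<in> B j" "x = i * K + k" by (auto simp: F_def split: if_splits)
    then show "x \<in> {..<D * b}" using pair_index_less[of i d k K] T B(1)[of j] total by auto
  qed
  have F_fin: "finite (F j)" for j using F_sub finite_subset by blast
  have F_card: "card (F j) \<le> b" for j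
  proof (cases "j \<in> T'")
    case True
    then have "card (F j) = card T * c j" using card_image[OF inj[OF True]] B(2)
      by (simp add: F_def card_cartesian_product)
    then show ?thesis using slots[OF True] by simp
  qed (simp add: F_def)
  have F_disj: "F i \<inter> F j = {}" if "i \<noteq> j" for i j
    using F_mem[of _ i] F_mem[of _ j] B(3)[of i j] that by blast
  \<comment> \<open>The unassigned pieces are exactly enough to bring every group up to size
    \<open>b\<close>. Whatever a group receives from them adds nonnegative mass, so the lower bound
    is unaffected.\<close>
  let ?R = "{..<D * b} - (\<Union>j<D. F j)"
  have "card (\<Union>j<D. F j) = (\<Sum>j<D. card (F j))"
    using F_fin F_disj by (intro card_UN_disjoint) auto
  moreover have "card ?R = D * b - card (\<Union>j<D. F j)"
    using F_sub F_fin by (subst card_Diff_subset) auto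
  moreover have "(\<Sum>j<D. b - card (F j)) = (\<Sum>j<D. b) - (\<Sum>j<D. card (F j))"
    using F_card by (intro sum_subtractf_nat) auto
  ultimately have "(\<Sum>j<D. b - card (F j)) \<le> card ?R" by simp
  then obtain H where H: "\<And>j. j \<in> {..<D} \<Longrightarrow> H j \<subseteq> ?R" "\<And>j. j \<in> {..<D} \<Longrightarrow> card (H j) = b - card (F j)"
    "\<And>i j. i \<in> {..<D} \<Longrightarrow> j \<in> {..<D} \<Longrightarrow> i \<noteq> j \<Longrightarrow> H i \<inter> H j = {}"
    using disjoint_subsets_with_cards[of "{..<D}" ?R "\<lambda>j. b - card (F j)"] by auto
  define G where "G j = F j \<union> H j" for j
  have H_fin: "finite (H j)" if "j < D" for j
    using H(1)[of j] that finite_subset[of "H j" "{..<D * b}"] by auto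
  have G_sub: "G j \<subseteq> {..<D * b}" if "j < D" for j
    using F_sub[of j] H(1)[of j] that by (auto simp: G_def)
  moreover have "card (G j) = b" if "j < D" for j
  proof -
    have "F j \<inter> H j = {}" using H(1)[of j] that by blast
    then show ?thesis
      using card_Un_disjoint[OF F_fin H_fin[OF that]] H(2)[of j] F_card[of j] that by (simp add: G_def)
  qed
  moreover have "G i \<inter> G j = {}" if "i < D" "j < D" "i \<noteq> j" for i j
    using F_disj[OF that(3)] H(3)[of i j] H(1)[of i] H(1)[of j] that unfolding G_def by blast
  moreover have "(\<Sum>i\<in>T. p i) * c j \<le> (\<Sum>x\<in>G j. p (x div K))" if j: "j \<in> T'" for j
  proof -
    have jD: "j < D" using j T' by auto
    have "(\<Sum>i\<in>T. p i) * c j = (\<Sum>(i, k)\<in>T \<times> B j. p i)"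
      by (simp add: B(2)[OF j] sum_distrib_right mult.commute flip: sum.cartesian_product)
    also have "\<dots> = (\<Sum>(i, k)\<in>T \<times> B j. p ((i * K + k) div K))"
      using B(1)[OF j] by (intro sum.cong refl) (auto simp: pair_index_div_mod)
    also have "\<dots> = (\<Sum>x\<in>F j. p (x div K))"
      using j sum.reindex[OF inj[OF j], of "\<lambda>x. p (x div K)"] by (simp add: F_def comp_def case_prod_unfold)
    also have "\<dots> \<le> (\<Sum>x\<in>G j. p (x div K))"
    proof (rule sum_mono2)
      show "finite (G j)" using F_fin H_fin[OF jD] by (simp add: G_def)
      fix x assume "x \<in> G j - F j"
      then have "x < d * K" using G_sub[OF jD] total by auto
      then show "0 \<le> p (x div K)" using p div_mod_less_mult by blast
    qed (simp add: G_def)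
    finally show ?thesis .
  qed
  ultimately show ?thesis by (rule that)
qed

text \<open>Block \<open>j\<close> of the positions runs through an enumeration of
  \<open>G j\<close>. Disjointness gives injectivity, and an injective self-map of a finite set is
  onto.\<close>

lemma permutation_of_grouping:
  assumes G: "\<And>j. j < D \<Longrightarrow> G j \<subseteq> {..<D * b}" "\<And>j. j < D \<Longrightarrow> card (G j) = b"
    "\<And>i j. i < D \<Longrightarrow> j < D \<Longrightarrow> i \<noteq> j \<Longrightarrow> G i \<inter> G j = {}"
  obtains \<pi> where "bij_betw \<pi> {..<D * b} {..<D * b}"
    "\<And>j. j < D \<Longrightarrow> bij_betw (\<lambda>s. \<pi> (j * b + s)) {..<b} (G j)"
proof -
  have "\<exists>h. bij_betw h {..<b} (G j)" if "j < D" for j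
    using ex_bij_betw_nat_finite[of "G j"] G(1,2)[OF that] finite_subset
    by (metis finite_lessThan lessThan_atLeast0)
  then obtain h where h: "\<And>j. j < D \<Longrightarrow> bij_betw (h j) {..<b} (G j)" by metis
  define \<pi> where "\<pi> y = h (y div b) (y mod b)" for y
  have mem: "\<pi> y \<in> G (y div b)" if "y < D * b" for y
    using h div_mod_less_mult[OF that] unfolding \<pi>_def bij_betw_def by blast
  have "inj_on \<pi> {..<D * b}"
  proof (rule inj_onI)
    fix y z assume "y \<in> {..<D * b}" "z \<in> {..<D * b}" and eq: "\<pi> y = \<pi> z"
    then have y: "y < D * b" and z: "z < D * b" by auto
    have "y div b = z div b"
      using mem[OF y] mem[OF z] eq G(3) div_mod_less_mult[OF y] div_mod_less_mult[OF z]
      by (metis IntI empty_iff)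
    moreover from this have "y mod b = z mod b"
      using h[of "y div b"] eq div_mod_less_mult[OF y] div_mod_less_mult[OF z]
      unfolding \<pi>_def bij_betw_def inj_on_def by auto
    ultimately show "y = z" by (metis div_mod_decomp)
  qed
  moreover have "\<pi> ` {..<D * b} \<subseteq> {..<D * b}"
    using mem G(1) div_mod_less_mult by blast
  ultimately have "bij_betw \<pi> {..<D * b} {..<D * b}"
    by (simp add: bij_betw_def endo_inj_surj)
  moreover have "bij_betw (\<lambda>s. \<pi> (j * b + s)) {..<b} (G j)" if "j < D" for j
    using h[OF that] by (subst bij_betw_cong[of _ _ "h j"]) (auto simp: \<pi>_def)
  ultimately show ?thesis by (rule that)
qed

text \<open>For equal totals the surplus equals the deficit, so it suffices to bound how far
  \<open>w\<close> falls short of \<open>q\<close>; the arbitrary filling of the groups then does no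
  harm. Pointwise, \<open>\<bar>x\<bar> \<le> x + 2 * e\<close> whenever \<open>- x \<le> e\<close>
  and \<open>0 \<le> e\<close>.\<close>

lemma l1_dist_le_deficit:
  fixes w q :: "nat \<Rightarrow> real"
  assumes "(\<Sum>j<D. w j) = (\<Sum>j<D. q j)" and "\<And>j. j < D \<Longrightarrow> q j - w j \<le> e j" "\<And>j. j < D \<Longrightarrow> 0 \<le> e j"
  shows "(\<Sum>j<D. \<bar>w j - q j\<bar>) \<le> 2 * (\<Sum>j<D. e j)"
proof -
  have "(\<Sum>j<D. \<bar>w j - q j\<bar>) \<le> (\<Sum>j<D. (w j - q j) + 2 * e j)"
    using assms(2,3) by (intro sum_mono) (smt (verit) lessThan_iff)
  also have "\<dots> = 2 * (\<Sum>j<D. e j)"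
    using assms(1) by (simp add: sum.distrib sum_subtractf sum_distrib_left)
  finally show ?thesis .
qed

text \<open>The parameter \<open>k\<close> sets how finely eigenvalues are split; rounding costs
  \<open>1 / real k\<close> in total deficit. Multiplied by \<open>k\<close>, the condition
  \<open>room\<close> says that \<open>card T * (K * q j)\<close> pieces fit into a group of size
  \<open>b\<close>.\<close>

lemma noisy_op_achievability:
  fixes p q :: "nat \<Rightarrow> real"
  assumes U: "unitary_mat d U" and V: "unitary_mat D V"
    and p: "\<And>i. i < d \<Longrightarrow> 0 \<le> p i" and sum_p: "(\<Sum>i<d. p i) = 1"
    and q: "\<And>j. j < D \<Longrightarrow> 0 \<le> q j" and sum_q: "(\<Sum>j<D. q j) = 1"
    and T: "T \<subseteq> {..<d}" and T': "T' \<subseteq> {..<D}"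
    and room: "\<And>j. j \<in> T' \<Longrightarrow> card T * q j * D \<le> d"
    and k: "k > 0"
  obtains \<Lambda> where "noisy_op d D \<Lambda>"
    "trace_norm (\<Lambda> (udiag d U p) - udiag D V q)
      \<le> 2 * ((\<Sum>i\<in>{..<d} - T. p i) + (\<Sum>j\<in>{..<D} - T'. q j) + 1 / real k)"
proof -
  have D: "D > 0" using sum_q by (cases D) auto
  \<comment> \<open>\<open>K\<close> is a multiple of \<open>D\<close> so that the
    \<open>d * K\<close> pieces divide into \<open>D\<close> groups of equal size
    \<open>b\<close>.\<close>
  define K b where "K = D * k" and "b = d * k"
  \<comment> \<open>Rounding down respects both the supply of labels and the group size, and costs a
    group at most \<open>1 / K\<close> of mass.\<close>
  define c where "c j = nat \<lfloor>real K * q j\<rfloor>" for j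
  have K: "K > 0" using D k by (simp add: K_def)
  have total: "d * K = D * b" by (simp add: K_def b_def)
  have c: "real (c j) \<le> K * q j" "K * q j - 1 \<le> real (c j)" if "j < D" for j
    using q[OF that] by (auto simp: c_def)
  have "real (\<Sum>j\<in>T'. c j) \<le> (\<Sum>j\<in>T'. K * q j)"
    unfolding of_nat_sum using c(1) T' by (intro sum_mono) auto
  also have "\<dots> \<le> (\<Sum>j<D. K * q j)" using T' q by (intro sum_mono2) auto
  also have "\<dots> = K" using sum_q by (simp flip: sum_distrib_left)
  finally have pieces: "(\<Sum>j\<in>T'. c j) \<le> K" by (simp only: of_nat_le_iff)
  have slots: "card T * c j \<le> b" if "j \<in> T'" for j
  proof -
    have "j < D" using that T' by auto
    then have "real (card T * c j) \<le> card T * (K * q j)"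
      unfolding of_nat_mult by (intro mult_left_mono c(1)) simp_all
    also have "\<dots> = (card T * q j * D) * k" by (simp add: K_def)
    also have "\<dots> \<le> real d * k" using room[OF that] by (intro mult_right_mono) auto
    finally have "real (card T * c j) \<le> real b" by (simp add: b_def)
    then show ?thesis by (simp only: of_nat_le_iff)
  qed
  obtain G where G: "\<And>j. j < D \<Longrightarrow> G j \<subseteq> {..<D * b}" "\<And>j. j < D \<Longrightarrow> card (G j) = b"
    "\<And>i j. i < D \<Longrightarrow> j < D \<Longrightarrow> i \<noteq> j \<Longrightarrow> G i \<inter> G j = {}"
    "\<And>j. j \<in> T' \<Longrightarrow> (\<Sum>i\<in>T. p i) * c j \<le> (\<Sum>x\<in>G j. p (x div K))"
    using balanced_grouping[where p = p, OF p T T' pieces slots total] by blast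
  obtain \<pi> where \<pi>: "bij_betw \<pi> {..<D * b} {..<D * b}"
    and \<pi>G: "\<And>j. j < D \<Longrightarrow> bij_betw (\<lambda>s. \<pi> (j * b + s)) {..<b} (G j)"
    using permutation_of_grouping[of D G b, OF G(1-3)] by blast
  define W where "W = perm_mat (D * b) \<pi>"
  have W: "unitary_mat (D * b) W" unfolding W_def by (rule unitary_perm_mat[OF \<pi>])
  define w where "w j = (\<Sum>s<b. p (\<pi> (j * b + s) div K) / K)" for j
  have wG: "w j = (\<Sum>x\<in>G j. p (x div K)) / K" if "j < D" for j
    unfolding w_def sum_divide_distrib using sum.reindex_bij_betw[OF \<pi>G[OF that]] .
  \<comment> \<open>Read from the inside: undo the eigenbasis of the source, split, permute and
    merge, install the eigenbasis of the target.\<close>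
  define \<Lambda> where "\<Lambda> = (\<lambda>X. V * X * mat_adjoint V) \<circ> ((\<lambda>X. partial_trace D b (W * X * mat_adjoint W)) \<circ>
    ((\<lambda>X. tensor_mat X (max_mixed K)) \<circ> (\<lambda>X. mat_adjoint U * X * mat_adjoint (mat_adjoint U))))"
  have "noisy_op d D \<Lambda>"
    unfolding \<Lambda>_def
  proof (intro noisy_op.comp noisy_op.step)
    show "noisy_step d d (\<lambda>X. mat_adjoint U * X * mat_adjoint (mat_adjoint U))"
      by (rule noisy_step.unitary[OF unitary_mat_adjoint[OF U]])
    show "noisy_step d (D * b) (\<lambda>X. tensor_mat X (max_mixed K))"
      using noisy_step.ancilla[OF K, of d] total by simp
    show "noisy_step (D * b) D (\<lambda>X. partial_trace D b (W * X * mat_adjoint W))"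
      by (rule noisy_step.discard[OF W])
    show "noisy_step D D (\<lambda>X. V * X * mat_adjoint V)" by (rule noisy_step.unitary[OF V])
  qed
  moreover have "\<Lambda> (udiag d U p) = udiag D V w"
  proof -
    have "mat_adjoint U * udiag d U p * mat_adjoint (mat_adjoint U) = mat_diag d (\<lambda>i. of_real (p i))"
      using udiag_conj[of U d "mat_adjoint U" p] U by (simp add: unitary_mat_def udiag_one_mat)
    then have "\<Lambda> (udiag d U p)
      = V * partial_trace D b (W * mat_diag (D * b) (\<lambda>x. of_real (p (x div K) / K)) * mat_adjoint W) * mat_adjoint V"
      unfolding \<Lambda>_def comp_def by (simp only: tensor_mat_diag_max_mixed total)
    then show ?thesis
      unfolding W_def perm_mat_conj_mat_diag[OF \<pi>] partial_trace_mat_diag udiag_def w_def .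
  qed
  moreover have "trace_norm (udiag D V w - udiag D V q)
      \<le> 2 * ((\<Sum>i\<in>{..<d} - T. p i) + (\<Sum>j\<in>{..<D} - T'. q j) + 1 / real k)"
  proof -
    define P where "P = (\<Sum>i\<in>T. p i)"
    have P: "1 - P = (\<Sum>i\<in>{..<d} - T. p i)"
      using sum.subset_diff[OF T finite_lessThan, of p] sum_p by (simp add: P_def)
    have P01: "0 \<le> P" "P \<le> 1"
    proof -
      show "0 \<le> P" using T p unfolding P_def by (intro sum_nonneg) auto
      have "0 \<le> (\<Sum>i\<in>{..<d} - T. p i)" using p by (intro sum_nonneg) auto
      then show "P \<le> 1" using P by simp
    qed
    have w0: "0 \<le> w j" if "j < D" for j
      unfolding wG[OF that]
    proof (intro divide_nonneg_nonneg sum_nonneg)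
      fix x assume "x \<in> G j"
      then have "x < d * K" using G(1)[OF that] total by auto
      then show "0 \<le> p (x div K)" using p div_mod_less_mult by blast
    qed simp
    have sum_w: "(\<Sum>j<D. w j) = (\<Sum>j<D. q j)"
    proof -
      have "(\<Sum>j<D. w j) = (\<Sum>y<D * b. p (\<pi> y div K) / K)"
        unfolding w_def sum_prod_index ..
      also have "\<dots> = (\<Sum>x<d * K. p (x div K) / K)"
        unfolding total by (rule sum.reindex_bij_betw[OF \<pi>])
      also have "\<dots> = (\<Sum>i<d. \<Sum>l<K. p i / K)"
        unfolding sum_prod_index by (intro sum.cong refl) (simp add: pair_index_div_mod)
      also have "\<dots> = 1" using K sum_p by simp
      finally show ?thesis using sum_q by simp
    qed
    \<comment> \<open>Three sources of deficit: source mass outside \<open>T\<close>, rounding, and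
      groups outside \<open>T'\<close>, which are charged all of \<open>q j\<close>.\<close>
    define e where "e j = (1 - P) * q j + 1 / K + (if j \<in> T' then 0 else q j)" for j
    have e: "q j - w j \<le> e j" if j: "j < D" for j
    proof (cases "j \<in> T'")
      case True
      have "P * (q j - 1 / K) = P * (K * q j - 1) / K" using K by (simp add: field_simps)
      also have "\<dots> \<le> P * c j / K"
        using c(2)[OF j] P01 by (intro divide_right_mono mult_left_mono) auto
      also have "\<dots> \<le> w j"
        unfolding wG[OF j] using G(4)[OF True] by (intro divide_right_mono) (auto simp: P_def)
      finally have "q j - w j \<le> q j - P * (q j - 1 / K)" by simp
      also have "\<dots> = (1 - P) * q j + P * (1 / K)" by (simp add: algebra_simps)
      also have "\<dots> \<le> (1 - P) * q j + 1 / K"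
        using P01 by (intro add_left_mono mult_left_le_one_le) auto
      finally show ?thesis using True by (simp add: e_def)
    next
      case False
      have "0 \<le> (1 - P) * q j" using P01 q[OF j] by simp
      moreover have "0 \<le> 1 / real K" by simp
      moreover have "e j = (1 - P) * q j + 1 / K + q j" using False by (simp add: e_def)
      ultimately show ?thesis using w0[OF j] by linarith
    qed
    have e0: "0 \<le> e j" if "j < D" for j
      using P01 q[OF that] by (simp add: e_def)
    have "(\<Sum>j<D. if j \<in> T' then 0 else q j) = (\<Sum>j\<in>{..<D} - T'. q j)"
      using T' by (simp add: sum.If_cases Int_absorb1 Diff_eq)
    then have "(\<Sum>j<D. e j) = (1 - P) + D / K + (\<Sum>j\<in>{..<D} - T'. q j)"
      using sum_q by (simp add: e_def sum.distrib flip: sum_distrib_left)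
    moreover have "D / K = 1 / k" using D by (simp add: K_def)
    moreover have "(\<Sum>j<D. \<bar>w j - q j\<bar>) \<le> 2 * (\<Sum>j<D. e j)"
      by (rule l1_dist_le_deficit[OF sum_w e e0])
    moreover have "trace_norm (udiag D V w - udiag D V q) = (\<Sum>j<D. \<bar>w j - q j\<bar>)"
      using udiag_diff[OF unitary_mat_carrier[OF V]] trace_norm_udiag[OF V] by simp
    ultimately show ?thesis using P by simp
  qed
  ultimately show ?thesis using that by metis
qed

subsection \<open>Asymptotic rates\<close>

abbreviation negentropy :: "nat \<Rightarrow> (nat \<Rightarrow> real) \<Rightarrow> real" where
  "negentropy d p \<equiv> log 2 (real d) - shannon d p"

context
  fixes d D :: nat and U V :: "complex mat" and p q :: "nat \<Rightarrow> real"
  assumes U: "unitary_mat d U" and V: "unitary_mat D V"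
    and p: "\<And>i. i < d \<Longrightarrow> 0 \<le> p i" and sum_p: "(\<Sum>i<d. p i) = 1"
    and q: "\<And>j. j < D \<Longrightarrow> 0 \<le> q j" and sum_q: "(\<Sum>j<D. q j) = 1"
begin


lemma dims_pos: "d > 0" "D > 0"
  using sum_p sum_q by (cases d; simp) (use sum_q in \<open>cases D; simp\<close>)

lemma power_eq_powr_log: "b > 0 \<Longrightarrow> real (b ^ n) = 2 powr (n * log 2 (real b))"
proof -
  assume "b > 0"
  have "2 powr (n * log 2 (real b)) = (2 powr log 2 (real b)) powr n" by (simp add: powr_powr mult.commute)
  then show ?thesis using \<open>b > 0\<close> by (simp add: powr_realpow)
qed

lemmas P_nonneg = prod_dist_nonneg[of d p, OF p sum_p]
lemmas Q_nonneg = prod_dist_nonneg[of D q, OF q sum_q]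

lemma pow_in: "unitary_mat (d ^ n) (tensor_pow U n)"
    "tensor_pow (udiag d U p) n = udiag (d ^ n) (tensor_pow U n) (prod_dist d p n)"
  and pow_out: "unitary_mat (D ^ m) (tensor_pow V m)"
    "tensor_pow (udiag D V q) m = udiag (D ^ m) (tensor_pow V m) (prod_dist D q m)"
  using tensor_pow_udiag[OF U] tensor_pow_udiag[OF V] by blast+

text \<open>\<open>trace_norm\<close> is evaluated through a definite description, so nonnegativity
  is derived for the Hermitian difference, by testing it with the identity.\<close>

lemma trace_norm_noisy_op_nonneg:
  assumes "noisy_op (d ^ n) (D ^ m) \<Lambda>"
  shows "0 \<le> trace_norm (\<Lambda> (tensor_pow (udiag d U p) n) - tensor_pow (udiag D V q) m)"
proof -
  have "has_dual (d ^ n) (D ^ m) \<Lambda>" using noisy_op_has_dual[OF assms] dims_pos by simp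
  moreover have "hermitian (d ^ n) (tensor_pow (udiag d U p) n)" "hermitian (D ^ m) (tensor_pow (udiag D V q) m)"
    unfolding pow_in(2) pow_out(2) using pow_in(1) pow_out(1) by (auto intro: hermitian_udiag)
  ultimately have "hermitian (D ^ m) (\<Lambda> (tensor_pow (udiag d U p) n) - tensor_pow (udiag D V q) m)"
    unfolding has_dual_def by (blast intro: hermitian_minus)
  from effect_trace_le_trace_norm[OF effect_udiag[OF pow_out(1), of _ "\<lambda>_. 1"] this]
  show ?thesis by (smt (verit))
qed

text \<open>The exponent combines the cap on the source eigenvalues, the count of \<open>T'\<close>
  and the two dimensions; the cap and the count contribute one \<open>t\<close> each.\<close>

lemma converse_bound:
  assumes noisy: "noisy_op (d ^ n) (D ^ m) \<Lambda>" and t: "t > 0"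
  shows "1 - (m * log_var D q / t\<^sup>2 + n * log_var d p / t\<^sup>2
      + trace_norm (\<Lambda> (tensor_pow (udiag d U p) n) - tensor_pow (udiag D V q) m))
    \<le> 2 powr (2 * t + n * negentropy d p - m * negentropy D q)"
proof -
  let ?P = "prod_dist d p n" and ?Q = "prod_dist D q m"
  define T where "T = {x. x < d ^ n \<and> ?P x \<le> 2 powr (t - n * shannon d p)}"
  define T' where "T' = {y. y < D ^ m \<and> 2 powr (- (t + m * shannon D q)) \<le> ?Q y}"
  have T: "T \<subseteq> {..<d ^ n}" and T': "T' \<subseteq> {..<D ^ m}" by (auto simp: T_def T'_def)
  have "{..<d ^ n} - T = {x. x < d ^ n \<and> ?P x > 2 powr (t - n * shannon d p)}"
    by (auto simp: T_def)
  then have tail_P: "(\<Sum>x\<in>{..<d ^ n} - T. ?P x) \<le> n * log_var d p / t\<^sup>2"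
    using prod_dist_large_tail[of d p, OF p sum_p t] by simp
  have "{..<D ^ m} - T' = {x. x < D ^ m \<and> ?Q x < 2 powr (- t - m * shannon D q)}"
    by (auto simp: T'_def)
  then have "(\<Sum>y\<in>{..<D ^ m} - T'. ?Q y) \<le> m * log_var D q / t\<^sup>2"
    using prod_dist_small_tail[of D q, OF q sum_q t] by simp
  moreover have "(\<Sum>y<D ^ m. ?Q y) = (\<Sum>y\<in>{..<D ^ m} - T'. ?Q y) + (\<Sum>y\<in>T'. ?Q y)"
    using T' by (intro sum.subset_diff) auto
  ultimately have mass_Q: "1 - m * log_var D q / t\<^sup>2 \<le> (\<Sum>y\<in>T'. ?Q y)"
    using sum_prod_dist[of D q, OF q sum_q] by simp
  have card: "card T' \<le> 2 powr (t + m * shannon D q)"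
    by (rule card_prod_dist_ge[of D q, OF q sum_q T']) (auto simp: T'_def)
  have "2 powr (t - n * shannon d p) * (real (d ^ n * card T') / real (D ^ m))
    \<le> 2 powr (t - n * shannon d p) * (2 powr (n * log 2 d) * 2 powr (t + m * shannon D q) / 2 powr (m * log 2 D))"
    unfolding of_nat_mult power_eq_powr_log[OF dims_pos(1)] power_eq_powr_log[OF dims_pos(2)]
    using card by (intro mult_left_mono divide_right_mono) auto
  also have "\<dots> = 2 powr (2 * t + n * negentropy d p - m * negentropy D q)"
    by (simp flip: powr_add powr_diff) (simp add: algebra_simps)
  finally have "2 powr (t - n * shannon d p) * (real (d ^ n * card T') / real (D ^ m))
    \<le> 2 powr (2 * t + n * negentropy d p - m * negentropy D q)" .
  moreover have "(\<Sum>y\<in>T'. ?Q y) - trace_norm (\<Lambda> (tensor_pow (udiag d U p) n) - tensor_pow (udiag D V q) m)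
    \<le> (\<Sum>x\<in>{..<d ^ n} - T. ?P x) + 2 powr (t - n * shannon d p) * (real (d ^ n * card T') / real (D ^ m))"
    unfolding pow_in(2) pow_out(2)
    by (rule noisy_op_converse[OF noisy _ pow_in(1) pow_out(1) P_nonneg T _ _ T'])
      (use dims_pos in \<open>auto simp: T_def\<close>)
  ultimately show ?thesis using mass_Q tail_P by linarith
qed

text \<open>By \<open>room\<close>, the count of \<open>T\<close> times the cap on the target
  eigenvalues times \<open>D ^ m\<close> is at most \<open>d ^ n\<close>. Existence includes
  \<open>t = 0\<close>, because an operation is demanded for every \<open>n\<close> and
  \<open>t\<close> will be a multiple of \<open>n\<close>; the error bound divides by
  \<open>t\<close> and so asks for \<open>t > 0\<close>.\<close>

lemma achievability_bound:
  assumes t: "0 \<le> t" and room: "m * negentropy D q + 2 * t \<le> n * negentropy d p" and k: "k > 0"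
  obtains \<Lambda> where "noisy_op (d ^ n) (D ^ m) \<Lambda>"
    "t > 0 \<Longrightarrow> trace_norm (\<Lambda> (tensor_pow (udiag d U p) n) - tensor_pow (udiag D V q) m)
      \<le> 2 * (n * log_var d p / t\<^sup>2 + m * log_var D q / t\<^sup>2 + 1 / real k)"
proof -
  let ?P = "prod_dist d p n" and ?Q = "prod_dist D q m"
  define T where "T = {x. x < d ^ n \<and> 2 powr (- (t + n * shannon d p)) \<le> ?P x}"
  define T' where "T' = {y. y < D ^ m \<and> ?Q y \<le> 2 powr (t - m * shannon D q)}"
  have T: "T \<subseteq> {..<d ^ n}" and T': "T' \<subseteq> {..<D ^ m}" by (auto simp: T_def T'_def)
  have card: "card T \<le> 2 powr (t + n * shannon d p)"
    by (rule card_prod_dist_ge[of d p, OF p sum_p T]) (auto simp: T_def)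
  have "card T * ?Q y * real (D ^ m) \<le> real (d ^ n)" if y: "y \<in> T'" for y
  proof -
    have "0 \<le> ?Q y" using Q_nonneg y T' by auto
    then have "card T * ?Q y * real (D ^ m)
      \<le> 2 powr (t + n * shannon d p) * 2 powr (t - m * shannon D q) * 2 powr (m * log 2 D)"
      unfolding power_eq_powr_log[OF dims_pos(2)]
      using card y by (intro mult_mono) (auto simp: T'_def)
    also have "\<dots> = 2 powr (2 * t + m * negentropy D q + n * shannon d p)"
      by (simp flip: powr_add) (simp add: algebra_simps)
    also have "\<dots> \<le> 2 powr (n * log 2 d)"
      using room by (intro powr_mono) (simp_all add: algebra_simps)
    finally show ?thesis unfolding power_eq_powr_log[OF dims_pos(1)] .
  qed
  then obtain \<Lambda> where \<Lambda>: "noisy_op (d ^ n) (D ^ m) \<Lambda>"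
    and err: "trace_norm (\<Lambda> (udiag (d ^ n) (tensor_pow U n) ?P) - udiag (D ^ m) (tensor_pow V m) ?Q)
      \<le> 2 * ((\<Sum>x\<in>{..<d ^ n} - T. ?P x) + (\<Sum>y\<in>{..<D ^ m} - T'. ?Q y) + 1 / real k)"
    using noisy_op_achievability[OF pow_in(1) pow_out(1) P_nonneg sum_prod_dist[of d p, OF p sum_p]
        Q_nonneg sum_prod_dist[of D q, OF q sum_q] T T' _ k] by metis
  show ?thesis
  proof (rule that[OF \<Lambda>])
    assume t: "t > 0"
    have "{..<d ^ n} - T = {x. x < d ^ n \<and> ?P x < 2 powr (- t - n * shannon d p)}"
      by (auto simp: T_def)
    then have "(\<Sum>x\<in>{..<d ^ n} - T. ?P x) \<le> n * log_var d p / t\<^sup>2"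
      using prod_dist_small_tail[of d p, OF p sum_p t] by simp
    moreover have "{..<D ^ m} - T' = {x. x < D ^ m \<and> ?Q x > 2 powr (t - m * shannon D q)}"
      by (auto simp: T'_def)
    then have "(\<Sum>y\<in>{..<D ^ m} - T'. ?Q y) \<le> m * log_var D q / t\<^sup>2"
      using prod_dist_large_tail[of D q, OF q sum_q t] by simp
    ultimately show "trace_norm (\<Lambda> (tensor_pow (udiag d U p) n) - tensor_pow (udiag D V q) m)
      \<le> 2 * (n * log_var d p / t\<^sup>2 + m * log_var D q / t\<^sup>2 + 1 / real k)"
      unfolding pow_in(2) pow_out(2)
      by (intro order_trans[OF err] mult_left_mono add_mono order_refl) simp_all
  qed
qed

section \<open>Passage from the bounds at finite size to rates\<close>

lemma dim_row_states: "dim_row (udiag d U p) = d" "dim_row (udiag D V q) = D"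
  using U V by simp_all

text \<open>Once the total error is below 1/2, the power of two in the converse bound is at least
  1/2, so its exponent is at least -1; divided by \<open>n\<close>, this constant disappears in the
  limit.\<close>

lemma achievable_rate_le:
  assumes "achievable_rate (udiag d U p) (udiag D V q) r"
  shows "r * negentropy D q \<le> negentropy d p"
proof (rule field_le_epsilon)
  fix \<epsilon> :: real assume "\<epsilon> > 0"
  \<comment> \<open>The exponent carries \<open>2 * t\<close> with \<open>t = \<delta> * n\<close>,
    hence half of \<epsilon>.\<close>
  define \<delta> where "\<delta> = \<epsilon> / 2"
  have \<delta>: "\<delta> > 0" using \<open>\<epsilon> > 0\<close> by (simp add: \<delta>_def)
  obtain m \<Lambda> where m: "(\<lambda>n. real (m n) / real n) \<longlonglongrightarrow> r"
    and \<Lambda>: "\<And>n. noisy_op (d ^ n) (D ^ m n) (\<Lambda> n)"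
    and tn: "(\<lambda>n. trace_norm (\<Lambda> n (tensor_pow (udiag d U p) n) - tensor_pow (udiag D V q) (m n))) \<longlonglongrightarrow> 0"
    using assms unfolding achievable_rate_def dim_row_states by blast
  define err where "err n = m n * log_var D q / (\<delta> * n)\<^sup>2 + n * log_var d p / (\<delta> * n)\<^sup>2
      + trace_norm (\<Lambda> n (tensor_pow (udiag d U p) n) - tensor_pow (udiag D V q) (m n))" for n
  have "(\<lambda>n. real (m n) / real n * (1 / real n) * (log_var D q / \<delta>\<^sup>2) + 1 / real n * (log_var d p / \<delta>\<^sup>2)
      + trace_norm (\<Lambda> n (tensor_pow (udiag d U p) n) - tensor_pow (udiag D V q) (m n)))
    \<longlonglongrightarrow> r * 0 * (log_var D q / \<delta>\<^sup>2) + 0 * (log_var d p / \<delta>\<^sup>2) + 0"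
    by (intro tendsto_intros m tn lim_1_over_n)
  moreover have "\<forall>\<^sub>F n in sequentially. real (m n) / real n * (1 / real n) * (log_var D q / \<delta>\<^sup>2)
      + 1 / real n * (log_var d p / \<delta>\<^sup>2) + trace_norm (\<Lambda> n (tensor_pow (udiag d U p) n) - tensor_pow (udiag D V q) (m n)) = err n"
    using eventually_gt_at_top[of 0]
    by eventually_elim (use \<delta> in \<open>simp add: err_def field_simps power2_eq_square\<close>)
  ultimately have "err \<longlonglongrightarrow> 0" by (simp add: tendsto_cong)
  then have "\<forall>\<^sub>F n in sequentially. err n < 1 / 2" by (rule order_tendstoD) simp
  then have ev: "\<forall>\<^sub>F n in sequentially. real (m n) / real n * negentropy D q \<le> 2 * \<delta> + negentropy d p + 1 / real n"
    using eventually_gt_at_top[of 0]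
  proof eventually_elim
    case (elim n)
    have "1 / 2 \<le> 2 powr (2 * (\<delta> * n) + n * negentropy d p - m n * negentropy D q)"
      using converse_bound[OF \<Lambda>, of "\<delta> * n" n] elim \<delta> unfolding err_def by simp
    then have "log 2 (1 / 2) \<le> 2 * (\<delta> * n) + n * negentropy d p - m n * negentropy D q"
      by (simp add: log_le_iff)
    then have "m n * negentropy D q \<le> n * (2 * \<delta> + negentropy d p) + 1" by (simp add: log_divide algebra_simps)
    then have "m n * negentropy D q / n \<le> (n * (2 * \<delta> + negentropy d p) + 1) / n" by (rule divide_right_mono) simp
    then show ?case using elim by (simp add: add_divide_distrib)
  qed
  have "(\<lambda>n. real (m n) / real n * negentropy D q) \<longlonglongrightarrow> r * negentropy D q"
    by (intro tendsto_mult tendsto_const m)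
  moreover have "(\<lambda>n. 2 * \<delta> + negentropy d p + 1 / real n) \<longlonglongrightarrow> 2 * \<delta> + negentropy d p + 0"
    by (intro tendsto_add[OF tendsto_const] lim_1_over_n)
  ultimately have "r * negentropy D q \<le> 2 * \<delta> + negentropy d p + 0"
    using ev by (intro tendsto_le[OF sequentially_bot])
  then show "r * negentropy D q \<le> negentropy d p + \<epsilon>" by (simp add: \<delta>_def)
qed

text \<open>The strict inequality leaves slack for a typicality window growing linearly in
  \<open>n\<close>. As \<open>negentropy D q\<close> is nonnegative, rounding the number of copies
  down only increases the room.\<close>

lemma achievable_rate_less:
  assumes r: "0 \<le> r" and gap: "0 \<le> negentropy D q" and less: "r * negentropy D q < negentropy d p"
  shows "achievable_rate (udiag d U p) (udiag D V q) r"
proof -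
  \<comment> \<open>Half the slack per copy, so that \<open>2 * (\<delta> * n)\<close> uses up all
    of it.\<close>
  define \<delta> where "\<delta> = (negentropy d p - r * negentropy D q) / 2"
  have \<delta>: "\<delta> > 0" using less by (simp add: \<delta>_def)
  define m where "m n = nat \<lfloor>r * real n\<rfloor>" for n
  have m_le: "real (m n) \<le> r * n" and m_ge: "r * n - 1 \<le> real (m n)" for n
    using r by (simp_all add: m_def)
  have m_lim: "(\<lambda>n. real (m n) / real n) \<longlonglongrightarrow> r"
  proof (rule tendsto_sandwich)
    show "\<forall>\<^sub>F n in sequentially. r - 1 / real n \<le> real (m n) / real n"
      using eventually_gt_at_top[of 0]
    proof eventually_elim
      case (elim n)
      have "(r * n - 1) / n \<le> real (m n) / n" using m_ge by (rule divide_right_mono) simp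
      then show ?case using elim by (simp add: diff_divide_distrib)
    qed
    show "\<forall>\<^sub>F n in sequentially. real (m n) / real n \<le> r"
      using eventually_gt_at_top[of 0] by eventually_elim (use m_le in \<open>simp add: pos_divide_le_eq\<close>)
    show "(\<lambda>n. r - 1 / real n) \<longlonglongrightarrow> r"
      using tendsto_diff[OF tendsto_const lim_1_over_n, of r] by simp
  qed simp
  have room: "m n * negentropy D q + 2 * (\<delta> * n) \<le> n * negentropy d p" for n
  proof -
    have "m n * negentropy D q \<le> r * n * negentropy D q" using m_le gap by (rule mult_right_mono)
    moreover have "r * n * negentropy D q + 2 * (\<delta> * n) = n * negentropy d p" by (simp add: \<delta>_def field_simps)
    ultimately show ?thesis by linarith
  qed
  have "\<exists>\<Lambda>. noisy_op (d ^ n) (D ^ m n) \<Lambda> \<and> (n > 0 \<longrightarrow>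
      trace_norm (\<Lambda> (tensor_pow (udiag d U p) n) - tensor_pow (udiag D V q) (m n))
      \<le> 2 * (n * log_var d p / (\<delta> * n)\<^sup>2 + m n * log_var D q / (\<delta> * n)\<^sup>2 + 1 / real (Suc n)))" for n
  \<comment> \<open>\<open>Suc n\<close> is positive even at \<open>n = 0\<close>, and its growth
    makes the rounding error vanish.\<close>
  proof (rule achievability_bound[where k = "Suc n", OF _ room[of n]])
    fix \<Lambda> assume "noisy_op (d ^ n) (D ^ m n) \<Lambda>"
      "0 < \<delta> * real n \<Longrightarrow> trace_norm (\<Lambda> (tensor_pow (udiag d U p) n) - tensor_pow (udiag D V q) (m n))
        \<le> 2 * (n * log_var d p / (\<delta> * n)\<^sup>2 + m n * log_var D q / (\<delta> * n)\<^sup>2 + 1 / real (Suc n))"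
    then show ?thesis using \<delta> by (intro exI[of _ \<Lambda>]) simp
  qed (use \<delta> in auto)
  then obtain \<Lambda> where \<Lambda>: "\<And>n. noisy_op (d ^ n) (D ^ m n) (\<Lambda> n)"
    and err: "\<And>n. n > 0 \<Longrightarrow> trace_norm (\<Lambda> n (tensor_pow (udiag d U p) n) - tensor_pow (udiag D V q) (m n))
      \<le> 2 * (n * log_var d p / (\<delta> * n)\<^sup>2 + m n * log_var D q / (\<delta> * n)\<^sup>2 + 1 / real (Suc n))"
    by metis
  have "(\<lambda>n. trace_norm (\<Lambda> n (tensor_pow (udiag d U p) n) - tensor_pow (udiag D V q) (m n))) \<longlonglongrightarrow> 0"
  proof (rule tendsto_sandwich)
    show "\<forall>\<^sub>F n in sequentially. 0 \<le> trace_norm (\<Lambda> n (tensor_pow (udiag d U p) n) - tensor_pow (udiag D V q) (m n))"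
      using trace_norm_noisy_op_nonneg[OF \<Lambda>] by simp
    show "\<forall>\<^sub>F n in sequentially. trace_norm (\<Lambda> n (tensor_pow (udiag d U p) n) - tensor_pow (udiag D V q) (m n))
      \<le> 2 * (1 / real n * (log_var d p / \<delta>\<^sup>2) + real (m n) / real n * (1 / real n) * (log_var D q / \<delta>\<^sup>2) + 1 / real n)"
      using eventually_gt_at_top[of 0]
    proof eventually_elim
      case (elim n)
      have eqs: "n * log_var d p / (\<delta> * n)\<^sup>2 = 1 / real n * (log_var d p / \<delta>\<^sup>2)"
        "m n * log_var D q / (\<delta> * n)\<^sup>2 = real (m n) / real n * (1 / real n) * (log_var D q / \<delta>\<^sup>2)"
        using elim \<delta> by (simp_all add: field_simps power2_eq_square)
      have "1 / real (Suc n) \<le> 1 / real n" using elim by (simp add: frac_le)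
      then show ?case
        using err[OF elim] unfolding eqs by (elim order_trans) (intro mult_left_mono add_mono order_refl, simp_all)
    qed
    have "(\<lambda>n. 2 * (1 / real n * (log_var d p / \<delta>\<^sup>2) + real (m n) / real n * (1 / real n) * (log_var D q / \<delta>\<^sup>2) + 1 / real n))
      \<longlonglongrightarrow> 2 * (0 * (log_var d p / \<delta>\<^sup>2) + r * 0 * (log_var D q / \<delta>\<^sup>2) + 0)"
      by (intro tendsto_intros m_lim lim_1_over_n)
    then show "(\<lambda>n. 2 * (1 / real n * (log_var d p / \<delta>\<^sup>2) + real (m n) / real n * (1 / real n) * (log_var D q / \<delta>\<^sup>2) + 1 / real n))
      \<longlonglongrightarrow> 0" by simp
  qed simp
  then show ?thesis
    unfolding achievable_rate_def dim_row_states using m_lim \<Lambda> by blast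
qed

text \<open>Zero copies of the target live on a one-dimensional space; with nothing cut off as
  atypical, only the rounding error remains. This keeps the supremum nonnegative also for a uniform
  source.\<close>

lemma achievable_rate_zero: "achievable_rate (udiag d U p) (udiag D V q) 0"
proof -
  have "\<exists>\<Lambda>. noisy_op (d ^ n) (D ^ 0) \<Lambda> \<and>
      trace_norm (\<Lambda> (tensor_pow (udiag d U p) n) - tensor_pow (udiag D V q) 0) \<le> 2 * (1 / real (Suc n))" for n
  proof (rule noisy_op_achievability[where T = "{..<d ^ n}" and T' = "{..<D ^ 0}" and k = "Suc n",
        OF pow_in(1) pow_out(1) P_nonneg sum_prod_dist[of d p, OF p sum_p]
        Q_nonneg sum_prod_dist[of D q, OF q sum_q]])
    fix \<Lambda> assume "noisy_op (d ^ n) (D ^ 0) \<Lambda>"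
      "trace_norm (\<Lambda> (udiag (d ^ n) (tensor_pow U n) (prod_dist d p n)) - udiag (D ^ 0) (tensor_pow V 0) (prod_dist D q 0))
      \<le> 2 * (sum (prod_dist d p n) ({..<d ^ n} - {..<d ^ n}) + sum (prod_dist D q 0) ({..<D ^ 0} - {..<D ^ 0}) + 1 / real (Suc n))"
    then show ?thesis unfolding pow_in(2) pow_out(2) by (intro exI[of _ \<Lambda>]) simp
  qed auto
  then obtain \<Lambda> where \<Lambda>: "\<And>n. noisy_op (d ^ n) (D ^ 0) (\<Lambda> n)"
    and err: "\<And>n. trace_norm (\<Lambda> n (tensor_pow (udiag d U p) n) - tensor_pow (udiag D V q) 0) \<le> 2 * (1 / real (Suc n))"
    by metis
  have "(\<lambda>n. 2 * (1 / real (Suc n))) \<longlonglongrightarrow> 2 * 0"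
    by (intro tendsto_intros LIMSEQ_Suc[OF lim_1_over_n])
  then have lim: "(\<lambda>n. 2 * (1 / real (Suc n))) \<longlonglongrightarrow> 0" by simp
  have "(\<lambda>n. trace_norm (\<Lambda> n (tensor_pow (udiag d U p) n) - tensor_pow (udiag D V q) 0)) \<longlonglongrightarrow> 0"
    by (rule tendsto_sandwich[OF _ _ tendsto_const lim])
      (use trace_norm_noisy_op_nonneg[OF \<Lambda>] err in auto)
  then show ?thesis
    unfolding achievable_rate_def dim_row_states
    by (intro exI[of _ "\<lambda>_. 0"] exI[of _ \<Lambda>]) (use \<Lambda> in simp)
qed

text \<open>The quotient bounds every achievable rate. A real number strictly between the supremum
  and the quotient would itself be achievable, a contradiction.\<close>

lemma optimal_rate_eq_negentropy_ratio:
  assumes gap: "negentropy D q > 0"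
  shows "optimal_rate (udiag d U p) (udiag D V q) = ereal (negentropy d p / negentropy D q)"
proof (rule antisym)
  show "optimal_rate (udiag d U p) (udiag D V q) \<le> ereal (negentropy d p / negentropy D q)"
    unfolding optimal_rate_def
  proof (rule Sup_least)
    fix x assume "x \<in> ereal ` {r. achievable_rate (udiag d U p) (udiag D V q) r}"
    then obtain r where r: "x = ereal r" "achievable_rate (udiag d U p) (udiag D V q) r" by auto
    then show "x \<le> ereal (negentropy d p / negentropy D q)"
      using achievable_rate_le[OF r(2)] gap by (simp add: pos_le_divide_eq)
  qed
  have upper: "ereal r \<le> optimal_rate (udiag d U p) (udiag D V q)" if "achievable_rate (udiag d U p) (udiag D V q) r" for r
    unfolding optimal_rate_def using that by (intro Sup_upper) auto
  show "ereal (negentropy d p / negentropy D q) \<le> optimal_rate (udiag d U p) (udiag D V q)"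
  proof (rule ccontr)
    assume "\<not> ereal (negentropy d p / negentropy D q) \<le> optimal_rate (udiag d U p) (udiag D V q)"
    then obtain r where r: "optimal_rate (udiag d U p) (udiag D V q) < ereal r" "ereal r < ereal (negentropy d p / negentropy D q)"
      using ereal_dense2 by (metis not_le)
    \<comment> \<open>This makes the intermediate rate \<open>r\<close> nonnegative, as
      \<open>achievable_rate_less\<close> demands.\<close>
    have "0 \<le> optimal_rate (udiag d U p) (udiag D V q)" using upper[OF achievable_rate_zero] by (simp add: zero_ereal_def)
    then have "0 \<le> r" using r(1) by (metis ereal_less_eq(5) less_imp_le order_trans)
    moreover have "r * negentropy D q < negentropy d p" using r(2) gap by (simp add: pos_less_divide_eq)
    ultimately have "achievable_rate (udiag d U p) (udiag D V q) r" using gap by (intro achievable_rate_less) auto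
    from upper[OF this] r(1) show False by simp
  qed
qed

end

text \<open>A constant spectrum looks the same in every eigenbasis. Read contrapositively, a state
  that is not maximally mixed has an eigenvalue other than \<open>1 / real d\<close>.\<close>

lemma udiag_const:
  assumes U: "unitary_mat d U" and const: "\<And>i. i < d \<Longrightarrow> p i = 1 / real d"
  shows "udiag d U p = max_mixed d"
proof (rule eq_matI)
  fix i j assume "i < dim_row (max_mixed d)" "j < dim_col (max_mixed d)"
  then have ij: "i < d" "j < d" by (auto simp: max_mixed_def)
  have "udiag d U p $$ (i, j) = (\<Sum>l<d. (U $$ (i, l) * cnj (U $$ (j, l))) / of_nat d)"
    unfolding index_udiag[OF unitary_mat_carrier[OF U] ij]
    by (intro sum.cong refl) (simp add: const)
  also have "\<dots> = max_mixed d $$ (i, j)"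
    using ij by (simp add: unitary_mat_rows[OF U ij] index_max_mixed flip: sum_divide_distrib)
  finally show "udiag d U p $$ (i, j) = max_mixed d $$ (i, j)" .
qed (use U in \<open>auto simp: max_mixed_def\<close>)

theorem mainTheorem3:
  fixes N N' :: nat and \<rho> \<sigma> :: "complex mat"
  assumes "state (2 ^ N) \<rho>"
    and "state (2 ^ N') \<sigma>"
    and "\<sigma> \<noteq> max_mixed (2 ^ N')"
  shows "optimal_rate \<rho> \<sigma> = ereal ((real N - entropy \<rho>) / (real N' - entropy \<sigma>))"
proof -
  obtain U p where U: "unitary_mat (2 ^ N) U" and \<rho>: "\<rho> = udiag (2 ^ N) U p"
    and p: "\<And>i. i < 2 ^ N \<Longrightarrow> 0 \<le> p i" "(\<Sum>i<2 ^ N. p i) = 1"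
    using state_diagonalization[OF assms(1)] by metis
  obtain V q where V: "unitary_mat (2 ^ N') V" and \<sigma>: "\<sigma> = udiag (2 ^ N') V q"
    and q: "\<And>j. j < 2 ^ N' \<Longrightarrow> 0 \<le> q j" "(\<Sum>j<2 ^ N'. q j) = 1"
    using state_diagonalization[OF assms(2)] by metis
  \<comment> \<open>One deviating eigenvalue pushes the entropy of \<open>\<sigma>\<close> strictly
    below \<open>N'\<close>, so the denominator is positive.\<close>
  obtain j where "j < 2 ^ N'" "q j \<noteq> 1 / real (2 ^ N')"
    using udiag_const[OF V, of q] assms(3) \<sigma> by auto
  then have "shannon (2 ^ N') q < log 2 (real (2 ^ N'))"
    using shannon_le_log(2)[of "2 ^ N'" q j] q by blast
  then have "optimal_rate \<rho> \<sigma> = ereal ((log 2 (real (2 ^ N)) - shannon (2 ^ N) p)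
      / (log 2 (real (2 ^ N')) - shannon (2 ^ N') q))"
    unfolding \<rho> \<sigma> by (intro optimal_rate_eq_negentropy_ratio[OF U V p q]) simp_all
  moreover have "log 2 (real (2 ^ n)) = n" for n by (simp add: log_nat_power)
  moreover have "entropy \<rho> = shannon (2 ^ N) p" "entropy \<sigma> = shannon (2 ^ N') q"
    unfolding \<rho> \<sigma> shannon_def entropy_udiag[OF U] entropy_udiag[OF V] by simp_all
  ultimately show ?thesis by simp
qed

end
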